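(* Consider the following discretization scheme in the absence of external contributions ($R=0$, $\boldsymbol f=0$): for $n\ge1$, given $\varphi_h^{n-1}\in Q_h$, find $\varphi_h^n,\mu_h^n\in Q_h$ and $\boldsymbol u_h^n\in\boldsymbol V_h$ such that $$\left(\frac{\varphi_h^n-\varphi_h^{n-1}}{\tau},q_h^\varphi\right)+(m\nabla\mu_h^n,\nabla q_h^\varphi)=0,$$ $$(\mu_h^n,q_h^\mu)-\gamma\ell(\nabla\varphi_h^n,\nabla q_h^\mu)-\frac{\gamma}{\ell}\left(\Psi_c'(\varphi_h^n)-\Psi_e'(\varphi_h^{n-1}),q_h^\mu\right)+\left(\mathbb C(\boldsymbol\varepsilon(\boldsymbol u_h^n)-\xi\varphi_h^n\boldsymbol I);q_h^\mu\xi\boldsymbol I\right)=0,$$ $$\left(\mathbb C(\boldsymbol\varepsilon(\boldsymbol u_h^n)-\xi\varphi_h^n\boldsymbol I);\boldsymbol\varepsilon(\boldsymbol v_h)\right)=0$$ for all $q_h^\varphi,q_h^\mu\in Q_h$ and all $\boldsymbol v_h\in\boldsymbol V_h$. This scheme is unconditionally gradient stable: with the free energy $$\mathcal E(\varphi,\boldsymbol u)=\int_\Omega\gamma\left(\frac1\ell\Psi(\varphi)+\frac\ell2|\nabla\varphi|^2\right)+\frac12\left(\boldsymbol\varepsilon(\boldsymbol u)-\xi\varphi\boldsymbol I\right):\mathbb C\left(\boldsymbol\varepsilon(\boldsymbol u)-\xi\varphi\boldsymbol I\right)dx,$$ one has, for every time-step size $\tau>0$ and every $n\ge 1$, $$\mathcal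 E(\varphi_h^n,\boldsymbol u_h^n)\le\mathcal E(\varphi_h^{n-1},\boldsymbol u_h^{n-1}).$$
   Context: Domain and spaces: $\Omega\subset\mathbb R^d$ is a bounded (connected) domain with Lipschitz boundary. $Q_h\subseteq H^1(\Omega)$ and $\boldsymbol V_h\subseteq (H^1_0(\Omega))^d$ are conforming finite element spaces (finite-dimensional spaces of piecewise polynomial functions; $Q_h$ contains the constants). $(\cdot,\cdot)$ is the $L^2(\Omega)$ inner product of scalar or vector functions, $(\cdot;\cdot)$ the $L^2(\Omega)$ inner product of second-order tensor functions, $:$ the pointwise contraction of second-order tensors. $\boldsymbol I$ is the identity tensor in $\mathbb R^{d\times d}$ and $\boldsymbol\varepsilon(\boldsymbol u)=\frac12(\nabla\boldsymbol u+\nabla\boldsymbol u^\top)$. The initial values are $\varphi_h^0\in Q_h$ and $\boldsymbol u_h^0\in\boldsymbol V_h$. Parameters: constants $\gamma,\ell,m>0$, $\xi\in\mathbb R$. Assumption on the double-well potential: $\Psi=\Psi_c-\Psi_e$ with $\Psi_c,\Psi_e:\mathbb R\to\mathbb R$ convex and differentiable, and $(\Psi_c'(a)-\Psi_c'(b))(a-b)\le L_{\Psi_c}(a-b)^2$ for all $a,b\in\mathbb R$, for a constant $L_{\Psi_c}$. Assumption on the elasticity tensor: $\mathbb C$ is a constant (phase-field-independent) fourth-order tensor for which there are constants $c_{\mathbb C},C_{\mathbb C}>0$ with $c_{\mathbb C}\|\boldsymbol e\|_{L^2(\Omega)}^2\le(\mathbb C\boldsymbol e;\boldsymbol e)\le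 C_{\mathbb C}\|\boldsymbol e\|_{L^2(\Omega)}^2$ for all symmetric second-order tensor functions $\boldsymbol e\in L^2(\Omega)$, and $(\boldsymbol e,\boldsymbol w)\mapsto(\mathbb C\boldsymbol e;\boldsymbol w)$ is an inner product (in particular symmetric). *)

theory Defs
  imports "HOL-Analysis.Analysis"
begin

section \<open>Lipschitz domains\<close>

text \<open>
  Near each boundary point the set is a strict epigraph over the hyperplane orthogonal to a
  unit vector \<open>e\<close>: a point splits as \<open>x = (x - (x \<bullet> e) e) + (x \<bullet> e) e\<close>.
\<close>

definition lipschitz_boundary :: "(real^'d::finite) set \<Rightarrow> bool" where
  "lipschitz_boundary \<Omega> \<longleftrightarrow>
     (\<forall>p\<in>frontier \<Omega>. \<exists>e r L g. norm e = 1 \<and> r > 0 \<and> L-lipschitz_on {y. y \<bullet> e = 0} g \<and>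
        (\<forall>x\<in>ball p r. x \<in> \<Omega> \<longleftrightarrow> g (x - (x \<bullet> e) *\<^sub>R e) < x \<bullet> e))"

definition lipschitz_domain :: "(real^'d::finite) set \<Rightarrow> bool" where
  "lipschitz_domain \<Omega> \<longleftrightarrow>
     \<Omega> \<noteq> {} \<and> open \<Omega> \<and> connected \<Omega> \<and> bounded \<Omega> \<and> lipschitz_boundary \<Omega>"


section \<open>Lebesgue and Sobolev spaces\<close>

text \<open>
  Elements of the function spaces are represented by functions on the whole space; only their
  values on \<open>\<Omega>\<close>, up to null sets, matter.
\<close>

definition L2 :: "(real^'d::finite) set \<Rightarrow> (real^'d \<Rightarrow> 'b::euclidean_space) set" where
  "L2 \<Omega> = {f. set_borel_measurable lebesgue \<Omega> f \<and>
               set_integrable lebesgue \<Omega> (\<lambda>x. (norm (f x))\<^sup>2)}"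

text \<open>
  At type \<open>real^'d^'d\<close> the inner product \<open>A \<bullet> B\<close> is the sum of \<open>A $ i $ j * B $ i $ j\<close> over
  \<open>i\<close> and \<open>j\<close>, i.e. the contraction \<open>A : B\<close>; so the next definition covers scalar, vector and
  tensor functions.
\<close>

definition L2_inner ::
    "(real^'d::finite) set \<Rightarrow> (real^'d \<Rightarrow> 'b::euclidean_space) \<Rightarrow> (real^'d \<Rightarrow> 'b) \<Rightarrow> real" where
  "L2_inner \<Omega> f g = (LINT x:\<Omega>|lebesgue. f x \<bullet> g x)"

definition partial_deriv :: "'d::finite \<Rightarrow> (real^'d \<Rightarrow> real) \<Rightarrow> real^'d \<Rightarrow> real" where
  "partial_deriv i f x = frechet_derivative f (at x) (axis i 1)"

primrec C_k :: "nat \<Rightarrow> (real^'d::finite \<Rightarrow> real) \<Rightarrow> bool" where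
  "C_k 0 f \<longleftrightarrow> continuous_on UNIV f"
| "C_k (Suc k) f \<longleftrightarrow> f differentiable_on UNIV \<and> (\<forall>i. C_k k (partial_deriv i f))"

definition test_function :: "(real^'d::finite) set \<Rightarrow> (real^'d \<Rightarrow> real) \<Rightarrow> bool" where
  "test_function \<Omega> \<eta> \<longleftrightarrow>
     (\<forall>k. C_k k \<eta>) \<and> compact (closure {x. \<eta> x \<noteq> 0}) \<and> closure {x. \<eta> x \<noteq> 0} \<subseteq> \<Omega>"

definition is_weak_gradient ::
    "(real^'d::finite) set \<Rightarrow> (real^'d \<Rightarrow> real) \<Rightarrow> (real^'d \<Rightarrow> real^'d) \<Rightarrow> bool" where
  "is_weak_gradient \<Omega> f g \<longleftrightarrow>
     (\<forall>\<eta>. test_function \<Omega> \<eta> \<longrightarrow>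
        (\<forall>i. (LINT x:\<Omega>|lebesgue. f x * partial_deriv i \<eta> x) =
             - (LINT x:\<Omega>|lebesgue. g x $ i * \<eta> x)))"

definition H1 :: "(real^'d::finite) set \<Rightarrow> (real^'d \<Rightarrow> real) set" where
  "H1 \<Omega> = {f \<in> L2 \<Omega>. \<exists>g\<in>L2 \<Omega>. is_weak_gradient \<Omega> f g}"

text \<open>
  The weak gradient of an \<open>H1\<close> function is unique only up to null sets; a representative is chosen.
\<close>

definition grad :: "(real^'d::finite) set \<Rightarrow> (real^'d \<Rightarrow> real) \<Rightarrow> real^'d \<Rightarrow> real^'d" where
  "grad \<Omega> f = (SOME g. g \<in> L2 \<Omega> \<and> is_weak_gradient \<Omega> f g)"

definition H1_norm :: "(real^'d::finite) set \<Rightarrow> (real^'d \<Rightarrow> real) \<Rightarrow> real" where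
  "H1_norm \<Omega> f = sqrt (L2_inner \<Omega> f f + L2_inner \<Omega> (grad \<Omega> f) (grad \<Omega> f))"

definition H1_0 :: "(real^'d::finite) set \<Rightarrow> (real^'d \<Rightarrow> real) set" where
  "H1_0 \<Omega> = {f \<in> H1 \<Omega>. \<exists>\<eta>. (\<forall>k. test_function \<Omega> (\<eta> k)) \<and>
                (\<lambda>k. H1_norm \<Omega> (\<lambda>x. f x - \<eta> k x)) \<longlonglongrightarrow> 0}"


section \<open>Finite element spaces\<close>

text \<open>
  A mesh is given by its open cells. They need not be simplices, since \<open>\<Omega>\<close> need not be
  polyhedral.
\<close>

definition mesh :: "(real^'d::finite) set \<Rightarrow> (real^'d) set set \<Rightarrow> bool" where
  "mesh \<Omega> \<T> \<longleftrightarrow>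
     finite \<T> \<and> disjoint \<T> \<and>
     (\<forall>K\<in>\<T>. K \<noteq> {} \<and> open K \<and> connected K \<and> K \<subseteq> \<Omega> \<and> negligible (frontier K)) \<and>
     (\<Union>K\<in>\<T>. closure K) = closure \<Omega>"

definition fe_space ::
    "(real^'d::finite) set \<Rightarrow> (real^'d \<Rightarrow> 'b::euclidean_space) set \<Rightarrow> bool" where
  "fe_space \<Omega> F \<longleftrightarrow>
     (\<exists>B. finite B \<and> F = {f. \<exists>c. f = (\<lambda>x. \<Sum>b\<in>B. c b *\<^sub>R b x)}) \<and>
     (\<exists>\<T>. mesh \<Omega> \<T> \<and>
        (\<forall>f\<in>F. \<forall>K\<in>\<T>. \<exists>p. polynomial_function p \<and> (\<forall>x\<in>K. f x = p x)))"

definition conforming_scalar_space ::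
    "(real^'d::finite) set \<Rightarrow> (real^'d \<Rightarrow> real) set \<Rightarrow> bool" where
  "conforming_scalar_space \<Omega> Q \<longleftrightarrow>
     fe_space \<Omega> Q \<and> Q \<subseteq> H1 \<Omega> \<and>
     (\<forall>c. \<exists>q\<in>Q. AE x in lebesgue. x \<in> \<Omega> \<longrightarrow> q x = c)"

definition conforming_vector_space ::
    "(real^'d::finite) set \<Rightarrow> (real^'d \<Rightarrow> real^'d) set \<Rightarrow> bool" where
  "conforming_vector_space \<Omega> V \<longleftrightarrow>
     fe_space \<Omega> V \<and> (\<forall>v\<in>V. \<forall>i. (\<lambda>x. v x $ i) \<in> H1_0 \<Omega>)"


section \<open>Elasticity\<close>

definition vgrad :: "(real^'d::finite) set \<Rightarrow> (real^'d \<Rightarrow> real^'d) \<Rightarrow> real^'d \<Rightarrow> real^'d^'d" where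
  "vgrad \<Omega> u x = (\<chi> i j. grad \<Omega> (\<lambda>y. u y $ i) x $ j)"

definition strain :: "(real^'d::finite) set \<Rightarrow> (real^'d \<Rightarrow> real^'d) \<Rightarrow> real^'d \<Rightarrow> real^'d^'d" where
  "strain \<Omega> u x = (1/2) *\<^sub>R (vgrad \<Omega> u x + transpose (vgrad \<Omega> u x))"

definition tensor_apply :: "real^'d^'d^'d^'d::finite \<Rightarrow> real^'d^'d \<Rightarrow> real^'d^'d" where
  "tensor_apply C e = (\<chi> i j. \<Sum>k\<in>UNIV. \<Sum>l\<in>UNIV. C $ i $ j $ k $ l * e $ k $ l)"

definition sym_L2 :: "(real^'d::finite) set \<Rightarrow> (real^'d \<Rightarrow> real^'d^'d) set" where
  "sym_L2 \<Omega> = {e \<in> L2 \<Omega>. \<forall>x\<in>\<Omega>. transpose (e x) = e x}"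

definition inner_product_on ::
    "(real^'d::finite) set \<Rightarrow> (real^'d \<Rightarrow> 'b::euclidean_space) set \<Rightarrow>
     ((real^'d \<Rightarrow> 'b) \<Rightarrow> (real^'d \<Rightarrow> 'b) \<Rightarrow> real) \<Rightarrow> bool" where
  "inner_product_on \<Omega> S a \<longleftrightarrow>
     (\<forall>e\<in>S. \<forall>w\<in>S. a e w = a w e) \<and>
     (\<forall>e\<in>S. \<forall>e'\<in>S. \<forall>w\<in>S. a (\<lambda>x. e x + e' x) w = a e w + a e' w) \<and>
     (\<forall>e\<in>S. \<forall>w\<in>S. \<forall>c. a (\<lambda>x. c *\<^sub>R e x) w = c * a e w) \<and>
     (\<forall>e\<in>S. a e e \<ge> 0 \<and> (a e e = 0 \<longrightarrow> (AE x in lebesgue. x \<in> \<Omega> \<longrightarrow> e x = 0)))"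

definition elasticity_tensor ::
    "(real^'d::finite) set \<Rightarrow> real^'d^'d^'d^'d \<Rightarrow> real \<Rightarrow> real \<Rightarrow> bool" where
  "elasticity_tensor \<Omega> C c\<^sub>C C\<^sub>C \<longleftrightarrow>
     c\<^sub>C > 0 \<and> C\<^sub>C > 0 \<and>
     (\<forall>e\<in>sym_L2 \<Omega>.
        c\<^sub>C * L2_inner \<Omega> e e \<le> L2_inner \<Omega> (\<lambda>x. tensor_apply C (e x)) e \<and>
        L2_inner \<Omega> (\<lambda>x. tensor_apply C (e x)) e \<le> C\<^sub>C * L2_inner \<Omega> e e) \<and>
     inner_product_on \<Omega> (sym_L2 \<Omega>) (\<lambda>e w. L2_inner \<Omega> (\<lambda>x. tensor_apply C (e x)) w)"


section \<open>Double-well potential, free energy and time discretization\<close>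

definition double_well_split ::
    "(real \<Rightarrow> real) \<Rightarrow> (real \<Rightarrow> real) \<Rightarrow> (real \<Rightarrow> real) \<Rightarrow> real \<Rightarrow> bool" where
  "double_well_split \<Psi> \<Psi>\<^sub>c \<Psi>\<^sub>e L \<longleftrightarrow>
     (\<forall>s. \<Psi> s = \<Psi>\<^sub>c s - \<Psi>\<^sub>e s) \<and>
     convex_on UNIV \<Psi>\<^sub>c \<and> convex_on UNIV \<Psi>\<^sub>e \<and>
     \<Psi>\<^sub>c differentiable_on UNIV \<and> \<Psi>\<^sub>e differentiable_on UNIV \<and>
     (\<forall>a b. (deriv \<Psi>\<^sub>c a - deriv \<Psi>\<^sub>c b) * (a - b) \<le> L * (a - b)\<^sup>2)"

definition elastic_strain ::
    "(real^'d::finite) set \<Rightarrow> real \<Rightarrow> (real^'d \<Rightarrow> real) \<Rightarrow> (real^'d \<Rightarrow> real^'d) \<Rightarrow>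
     real^'d \<Rightarrow> real^'d^'d" where
  "elastic_strain \<Omega> \<xi> \<phi> u x = strain \<Omega> u x - (\<xi> * \<phi> x) *\<^sub>R mat 1"

definition free_energy ::
    "(real^'d::finite) set \<Rightarrow> real \<Rightarrow> real \<Rightarrow> real \<Rightarrow> (real \<Rightarrow> real) \<Rightarrow> real^'d^'d^'d^'d \<Rightarrow>
     (real^'d \<Rightarrow> real) \<Rightarrow> (real^'d \<Rightarrow> real^'d) \<Rightarrow> real" where
  "free_energy \<Omega> \<gamma> \<l> \<xi> \<Psi> C \<phi> u =
     (LINT x:\<Omega>|lebesgue.
        \<gamma> * (1 / \<l> * \<Psi> (\<phi> x) + \<l> / 2 * (norm (grad \<Omega> \<phi> x))\<^sup>2) +
        1/2 * (elastic_strain \<Omega> \<xi> \<phi> u x \<bullet> tensor_apply C (elastic_strain \<Omega> \<xi> \<phi> u x)))"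

definition time_step ::
    "(real^'d::finite) set \<Rightarrow> (real^'d \<Rightarrow> real) set \<Rightarrow> (real^'d \<Rightarrow> real^'d) set \<Rightarrow>
     real \<Rightarrow> real \<Rightarrow> real \<Rightarrow> real \<Rightarrow> (real \<Rightarrow> real) \<Rightarrow> (real \<Rightarrow> real) \<Rightarrow> real^'d^'d^'d^'d \<Rightarrow> real \<Rightarrow>
     (real^'d \<Rightarrow> real) \<Rightarrow> (real^'d \<Rightarrow> real) \<Rightarrow> (real^'d \<Rightarrow> real) \<Rightarrow> (real^'d \<Rightarrow> real^'d) \<Rightarrow> bool" where
  "time_step \<Omega> Q V \<gamma> \<l> m \<xi> \<Psi>\<^sub>c \<Psi>\<^sub>e C \<tau> \<phi>' \<phi> \<mu> u \<longleftrightarrow>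
     \<phi> \<in> Q \<and> \<mu> \<in> Q \<and> u \<in> V \<and>
     (\<forall>q\<in>Q. L2_inner \<Omega> (\<lambda>x. (\<phi> x - \<phi>' x) / \<tau>) q
             + L2_inner \<Omega> (\<lambda>x. m *\<^sub>R grad \<Omega> \<mu> x) (grad \<Omega> q) = 0) \<and>
     (\<forall>q\<in>Q. L2_inner \<Omega> \<mu> q
             - \<gamma> * \<l> * L2_inner \<Omega> (grad \<Omega> \<phi>) (grad \<Omega> q)
             - \<gamma> / \<l> * L2_inner \<Omega> (\<lambda>x. deriv \<Psi>\<^sub>c (\<phi> x) - deriv \<Psi>\<^sub>e (\<phi>' x)) q
             + L2_inner \<Omega> (\<lambda>x. tensor_apply C (elastic_strain \<Omega> \<xi> \<phi> u x))
                           (\<lambda>x. (q x * \<xi>) *\<^sub>R mat 1) = 0) \<and>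
     (\<forall>v\<in>V. L2_inner \<Omega> (\<lambda>x. tensor_apply C (elastic_strain \<Omega> \<xi> \<phi> u x)) (strain \<Omega> v) = 0)"

end

theory Submission
  imports Defs
begin

text \<open>
  Write \<open>\<phi>'\<close>, \<open>u'\<close> for the old and \<open>\<phi>\<close>, \<open>\<mu>\<close>, \<open>u\<close> for the new iterates, and \<open>E'\<close>, \<open>E\<close> for the
  corresponding elastic strains. The three equations may be tested with \<open>\<mu>\<close>, \<open>\<phi> - \<phi>'\<close> and
  \<open>u - u'\<close>. The first gives \<open>(\<mu>, \<phi> - \<phi>') = - \<tau> m (\<nabla>\<mu>, \<nabla>\<mu>) \<le> 0\<close>
  (\<open>chemical_potential_work_nonpos\<close>). The other two express the same number as the sum of
  \<^item> \<open>\<gamma> \<l> (\<nabla>\<phi>, \<nabla>(\<phi> - \<phi>'))\<close>,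
  \<^item> \<open>(\<gamma> / \<l>) (\<Psi>c'(\<phi>) - \<Psi>e'(\<phi>'), \<phi> - \<phi>')\<close> and
  \<^item> \<open>(C E; E - E')\<close>, since \<open>E - E' = \<epsilon>(u - u') - \<xi> (\<phi> - \<phi>') I\<close>.
  
  Each of them bounds the increment of the corresponding part of the energy from above. For the
  two quadratic parts this is \<open>a(e, e) / 2 - a(e', e') / 2 \<le> a(e, e - e')\<close>, which is
  \<open>a(e - e', e - e') \<ge> 0\<close> (\<open>inner_product_on_convex\<close>). For the potential it is the reason for
  treating the convex part implicitly and the concave part explicitly: the tangent of \<open>\<Psi>c\<close> at the new
  value and that of \<open>\<Psi>e\<close> at the old value both err on the favourable side (\<open>double_well_split_le\<close>).
  
  The argument needs two analytic facts. Firstly \<open>\<nabla>(\<phi> - \<phi>') = \<nabla>\<phi> - \<nabla>\<phi>'\<close> almost everywhere. A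
  weak gradient is only some representative, so this is the uniqueness of weak gradients
  (\<open>is_weak_gradient_unique\<close>), i.e. the fundamental lemma of the calculus of variations
  (\<open>AE_eq_0_if_test_integrals_vanish\<close>), which in turn rests on explicit smooth approximations of
  indicators of boxes. Secondly the integrals of \<open>\<Psi>(\<phi>)\<close> and of the derivative terms have to exist.
  No growth condition on the potential is available for that; instead, finite element functions are
  essentially bounded (\<open>fe_space_AE_bounded\<close>).
\<close>

section \<open>Smooth cut-off functions\<close>

lemma partial_deriv_eqI:
  assumes "(f has_derivative D) (at x)"
  shows "partial_deriv i f x = D (axis i 1)"
  using frechet_derivative_at[OF assms] by (simp add: partial_deriv_def)

lemma differentiable_on_UNIV_D:
  "f differentiable_on UNIV \<Longrightarrow> (f has_derivative frechet_derivative f (at x)) (at x)"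
  by (simp add: differentiable_on_def frechet_derivative_works[symmetric])

lemma C_k_const: "C_k k (\<lambda>x. c)"
proof (induction k arbitrary: c)
  case (Suc k)
  have "partial_deriv i (\<lambda>x::real^'a. c) = (\<lambda>x. 0)" for i
    by (rule ext) (simp add: partial_deriv_eqI[OF has_derivative_const])
  then show ?case using Suc by simp
qed simp

lemma C_k_SucD: "C_k (Suc k) f \<Longrightarrow> C_k k f"
proof (induction k arbitrary: f)
  case 0
  then show ?case by (simp add: differentiable_imp_continuous_on)
next
  case (Suc k)
  from Suc.prems Suc.IH show ?case by (metis C_k.simps(2))
qed

lemma C_k_add: "C_k k f \<Longrightarrow> C_k k g \<Longrightarrow> C_k k (\<lambda>x. f x + g x)"
proof (induction k arbitrary: f g)
  case 0
  then show ?case by (simp add: continuous_on_add)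
next
  case (Suc k)
  then have d: "f differentiable_on UNIV" "g differentiable_on UNIV" by auto
  have "partial_deriv i (\<lambda>x. f x + g x) = (\<lambda>x. partial_deriv i f x + partial_deriv i g x)" for i
    by (rule ext, subst partial_deriv_eqI
          [OF has_derivative_add[OF d[THEN differentiable_on_UNIV_D]]])
       (simp add: partial_deriv_def)
  then show ?case using Suc d by simp
qed

lemma C_k_mult: "C_k k f \<Longrightarrow> C_k k g \<Longrightarrow> C_k k (\<lambda>x. f x * g x)"
proof (induction k arbitrary: f g)
  case 0
  then show ?case by (simp add: continuous_on_mult)
next
  case (Suc k)
  then have d: "f differentiable_on UNIV" "g differentiable_on UNIV" by auto
  have *: "partial_deriv i (\<lambda>x. f x * g x)
        = (\<lambda>x. f x * partial_deriv i g x + partial_deriv i f x * g x)" for i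
    by (rule ext, subst partial_deriv_eqI
          [OF has_derivative_mult[OF d[THEN differentiable_on_UNIV_D]]])
       (simp add: partial_deriv_def)
  show ?case using Suc d C_k_SucD[OF Suc.prems(1)] C_k_SucD[OF Suc.prems(2)]
    by (simp add: * C_k_add)
qed

lemma C_k_prod:
  "finite I \<Longrightarrow> (\<And>i. i \<in> I \<Longrightarrow> C_k k (f i)) \<Longrightarrow> C_k k (\<lambda>x. \<Prod>i\<in>I. f i x)"
  by (induction I rule: finite_induct) (auto intro: C_k_const C_k_mult)

text \<open>
  The classical flat function \<open>exp (- 1 / t)\<close> is the member for \<open>p = 1\<close>. The polynomial factor makes
  the family closed under differentiation, which turns smoothness into a plain induction.
\<close>

definition flat :: "real poly \<Rightarrow> real \<Rightarrow> real" where
  "flat p t = (if t > 0 then poly p (1 / t) * exp (- (1 / t)) else 0)"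

lemma poly_times_exp_minus_tendsto_0:
  fixes p :: "real poly"
  shows "((\<lambda>s. poly p s * exp (- s)) \<longlongrightarrow> 0) at_top"
proof -
  have "((\<lambda>s. \<Sum>i\<le>degree p. coeff p i * (s ^ i / exp s)) \<longlongrightarrow> (\<Sum>i\<le>degree p. coeff p i * 0)) at_top"
    by (intro tendsto_sum tendsto_mult tendsto_const tendsto_power_div_exp_0)
  moreover have "poly p s * exp (- s) = (\<Sum>i\<le>degree p. coeff p i * (s ^ i / exp s))" for s
    by (simp add: poly_altdef sum_distrib_right exp_minus divide_inverse mult.assoc)
  ultimately show ?thesis by simp
qed

lemma flat_tendsto_0: "(flat p \<longlongrightarrow> 0) (at 0)"
proof -
  have "((\<lambda>t. poly p (inverse t) * exp (- inverse t)) \<longlongrightarrow> 0) (at_right 0)"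
    by (rule filterlim_compose[OF poly_times_exp_minus_tendsto_0 filterlim_inverse_at_top_right])
  then have "(flat p \<longlongrightarrow> 0) (at_right 0)"
    by (rule Lim_transform_eventually)
       (auto simp: eventually_at_filter flat_def field_simps)
  moreover have "(flat p \<longlongrightarrow> 0) (at_left 0)"
    by (rule Lim_transform_eventually[OF tendsto_const])
       (auto simp: eventually_at_filter flat_def)
  ultimately show ?thesis by (simp add: filterlim_split_at)
qed

lemma flat_has_derivative:
  "(flat p has_real_derivative flat ([:0, 0, 1:] * (p - pderiv p)) t) (at t)"
proof -
  consider "t > 0" | "t < 0" | "t = 0" by linarith
  then show ?thesis
  proof cases
    case 1
    have "((\<lambda>t. poly p (1 / t) * exp (- (1 / t))) has_real_derivative
            flat ([:0, 0, 1:] * (p - pderiv p)) t) (at t)"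
      using 1 by (auto intro!: derivative_eq_intros DERIV_chain'[OF _ poly_DERIV]
          simp: flat_def field_simps power2_eq_square)
    then show ?thesis
      by (rule has_field_derivative_transform_within_open[of _ _ _ "{0<..}"])
         (use 1 in \<open>auto simp: flat_def\<close>)
  next
    case 2
    have "((\<lambda>t. 0) has_real_derivative flat ([:0, 0, 1:] * (p - pderiv p)) t) (at t)"
      using 2 by (simp add: flat_def)
    then show ?thesis
      by (rule has_field_derivative_transform_within_open[of _ _ _ "{..<0}"])
         (use 2 in \<open>auto simp: flat_def\<close>)
  next
    case 3
    \<comment> \<open>the difference quotient at \<open>0\<close> is again a member of the family\<close>
    have "(\<lambda>h. (flat p (0 + h) - flat p 0) / h) = flat ([:0, 1:] * p)"
      by (rule ext) (auto simp: flat_def)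
    then show ?thesis
      using flat_tendsto_0[of "[:0, 1:] * p"] 3 by (simp add: DERIV_def flat_def[of _ 0])
  qed
qed

lemma C_k_flat: "C_k k (\<lambda>x. c * flat p (s * x $ i + b))"
proof (induction k arbitrary: c p)
  have D: "((\<lambda>x. c * flat p (s * x $ i + b)) has_derivative
      (\<lambda>h. c * (flat ([:0, 0, 1:] * (p - pderiv p)) (s * x $ i + b) * (s * h $ i)))) (at x)"
    for c p and x :: "real^'a"
  proof -
    have 1: "((\<lambda>x::real^'a. s * x $ i + b) has_derivative (\<lambda>h. s * h $ i)) (at x)"
      by (auto intro!: derivative_eq_intros bounded_linear.has_derivative[OF bounded_linear_vec_nth])
    show ?thesis
      by (intro has_derivative_mult_right
          has_derivative_compose[OF 1 flat_has_derivative[unfolded has_field_derivative_def]])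
  qed
  have d: "(\<lambda>x::real^'a. c * flat p (s * x $ i + b)) differentiable_on UNIV" for c p
    unfolding differentiable_on_def differentiable_def using D by blast
  {
    case 0
    show ?case using d by (simp add: differentiable_imp_continuous_on)
  next
    case (Suc k)
    have "partial_deriv j (\<lambda>x. c * flat p (s * x $ i + b))
        = (\<lambda>x. (c * (if i = j then s else 0))
               * flat ([:0, 0, 1:] * (p - pderiv p)) (s * x $ i + b))" for j
      by (rule ext, subst partial_deriv_eqI[OF D]) (simp add: axis_def)
    then show ?case using Suc d by simp
  }
qed

text \<open>
  A product of one-dimensional cut-offs is positive exactly on the open box, so its support lies in the
  closed box whatever \<open>k\<close> is; increasing \<open>k\<close> only steepens it. The factor is \<open>Suc k\<close> because \<open>0\<close> would
  give the zero function.
\<close>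

definition box_cutoff :: "real^'d::finite \<Rightarrow> real^'d \<Rightarrow> nat \<Rightarrow> real^'d \<Rightarrow> real" where
  "box_cutoff a b k x =
     (\<Prod>i\<in>UNIV. flat 1 (real (Suc k) * (x $ i - a $ i)) * flat 1 (real (Suc k) * (b $ i - x $ i)))"

lemma C_k_box_cutoff: "C_k n (box_cutoff a b k)"
proof -
  have *: "box_cutoff a b k = (\<lambda>x. \<Prod>i\<in>UNIV.
      (1 * flat 1 (real (Suc k) * x $ i + - (real (Suc k) * a $ i))) *
      (1 * flat 1 (- real (Suc k) * x $ i + real (Suc k) * b $ i)))"
    by (rule ext) (simp add: box_cutoff_def algebra_simps)
  show ?thesis
    unfolding * by (intro C_k_prod C_k_mult C_k_flat) simp
qed

lemma flat_1_bounds: "0 \<le> flat 1 t" "flat 1 t \<le> 1"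
  by (auto simp: flat_def)

lemma box_cutoff_bounds: "0 \<le> box_cutoff a b k x" "box_cutoff a b k x \<le> 1"
  unfolding box_cutoff_def
  by (auto intro!: prod_nonneg prod_le_1 mult_nonneg_nonneg mult_le_one flat_1_bounds)

lemma box_cutoff_eq_0_iff: "box_cutoff a b k x = 0 \<longleftrightarrow> x \<notin> box a b"
proof -
  have "flat 1 (real (Suc k) * t) = 0 \<longleftrightarrow> t \<le> 0" for t
    by (simp only: flat_def) (simp add: mult_le_0_iff zero_less_mult_iff not_less)
  then show ?thesis
    by (auto simp: box_cutoff_def mem_box_cart not_less simp del: of_nat_Suc)
qed

lemma test_function_box_cutoff:
  assumes "cbox a b \<subseteq> \<Omega>"
  shows "test_function \<Omega> (box_cutoff a b k)"
proof -
  have "{x. box_cutoff a b k x \<noteq> 0} = box a b" by (simp add: box_cutoff_eq_0_iff)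
  moreover have "closure (box a b) \<subseteq> cbox a b"
    by (rule closure_minimal[OF box_subset_cbox closed_cbox])
  ultimately show ?thesis
    using assms C_k_box_cutoff
    by (auto simp: test_function_def intro: bounded_subset[OF bounded_box])
qed

text \<open>
  Dilating the argument of \<open>exp (- 1 / t)\<close> flattens it towards \<open>1\<close> on the positive half line.
\<close>

lemma box_cutoff_tendsto_indicator:
  "(\<lambda>k. box_cutoff a b k x) \<longlonglongrightarrow> indicator (box a b) x"
proof (cases "x \<in> box a b")
  case False
  then have "box_cutoff a b k x = 0" for k by (simp add: box_cutoff_eq_0_iff)
  then show ?thesis using False by simp
next
  case True
  have *: "(\<lambda>k. flat 1 (real (Suc k) * t)) \<longlonglongrightarrow> 1" if "t > 0" for t
  proof -
    have "(\<lambda>k. exp (- ((1 / t) * inverse (real (Suc k))))) \<longlonglongrightarrow> exp (- ((1 / t) * 0))"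
      by (intro tendsto_intros LIMSEQ_inverse_real_of_nat)
    moreover have "exp (- ((1 / t) * inverse (real (Suc k)))) = flat 1 (real (Suc k) * t)" for k
      using that by (simp add: flat_def zero_less_mult_iff field_simps del: of_nat_Suc)
    ultimately show ?thesis by simp
  qed
  have "(\<lambda>k. box_cutoff a b k x) \<longlonglongrightarrow> (\<Prod>i\<in>(UNIV::'a set). 1 * 1)"
    unfolding box_cutoff_def using True
    by (intro tendsto_prod tendsto_mult *) (auto simp: mem_box_cart)
  then show ?thesis using True by simp
qed

section \<open>The fundamental lemma of the calculus of variations\<close>

text \<open>
  The cut-offs are bounded by \<open>1\<close> and converge to the indicator of the box, so dominated convergence
  passes from test functions to the indicator.
\<close>

lemma integral_box_eq_0:
  fixes f :: "real^'d::finite \<Rightarrow> real"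
  assumes \<Omega>: "\<Omega> \<in> sets lebesgue" and f: "integrable (lebesgue_on \<Omega>) f"
    and zero: "\<And>\<eta>. test_function \<Omega> \<eta> \<Longrightarrow> (LINT x|lebesgue_on \<Omega>. f x * \<eta> x) = 0"
    and box: "cbox a b \<subseteq> \<Omega>"
  shows "(LINT x|lebesgue_on \<Omega>. f x * indicator (box a b) x) = 0"
proof -
  have cm: "box_cutoff a b k \<in> borel_measurable (lebesgue_on \<Omega>)" for k
    using C_k_box_cutoff[of 0 a b k] \<Omega>
    by (auto intro: continuous_imp_measurable_on_sets_lebesgue continuous_on_subset)
  have fm: "f \<in> borel_measurable (lebesgue_on \<Omega>)" using f by auto
  have "(\<lambda>k. LINT x|lebesgue_on \<Omega>. f x * box_cutoff a b k x)
      \<longlonglongrightarrow> (LINT x|lebesgue_on \<Omega>. f x * indicator (box a b) x)"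
  proof (rule integral_dominated_convergence[where w = "\<lambda>x. \<bar>f x\<bar>"])
    have "indicator (box a b) \<in> borel_measurable (lebesgue_on \<Omega>)"
      by (intro measurable_restrict_space1 borel_measurable_indicator) simp
    then show "(\<lambda>x. f x * indicator (box a b) x) \<in> borel_measurable (lebesgue_on \<Omega>)"
      using fm by measurable
    show "(\<lambda>x. f x * box_cutoff a b k x) \<in> borel_measurable (lebesgue_on \<Omega>)" for k
      using fm cm by measurable
    show "integrable (lebesgue_on \<Omega>) (\<lambda>x. \<bar>f x\<bar>)" using f by simp
    show "AE x in lebesgue_on \<Omega>. (\<lambda>k. f x * box_cutoff a b k x)
        \<longlonglongrightarrow> f x * indicator (box a b) x"
      by (intro AE_I2 tendsto_mult tendsto_const box_cutoff_tendsto_indicator)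
    show "AE x in lebesgue_on \<Omega>. norm (f x * box_cutoff a b k x) \<le> \<bar>f x\<bar>" for k
      by (intro AE_I2) (simp add: abs_mult box_cutoff_bounds mult_left_le)
  qed
  moreover have "(LINT x|lebesgue_on \<Omega>. f x * box_cutoff a b k x) = 0" for k
    by (rule zero[OF test_function_box_cutoff[OF box]])
  ultimately show ?thesis by (simp add: LIMSEQ_const_iff)
qed

text \<open>
  By Lebesgue differentiation, almost every value of \<open>f\<close> is the limit of the averages over the cubes
  with lower corner \<open>x\<close>. Small cubes lie in the open set \<open>\<Omega>\<close>, where these averages vanish.
\<close>

lemma AE_eq_0_if_test_integrals_vanish:
  fixes f :: "real^'d::finite \<Rightarrow> real"
  assumes \<Omega>: "open \<Omega>" and f: "integrable (lebesgue_on \<Omega>) f"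
    and zero: "\<And>\<eta>. test_function \<Omega> \<eta> \<Longrightarrow> (LINT x|lebesgue_on \<Omega>. f x * \<eta> x) = 0"
  shows "AE x in lebesgue_on \<Omega>. f x = 0"
proof -
  have \<Omega>m: "\<Omega> \<in> sets lebesgue" using \<Omega> by auto
  \<comment> \<open>extension by zero, because the differentiation theorem is stated on the whole space\<close>
  define F where "F x = indicator \<Omega> x *\<^sub>R f x" for x
  have F: "integrable lebesgue F"
    using f \<Omega>m unfolding F_def by (simp add: integrable_restrict_space)
  have Fbox: "integrable (lebesgue_on (cbox a b)) F" for a b
    using integrable_mult_indicator[OF _ F, of "cbox a b"] by (simp add: integrable_restrict_space)
  have int: "F integrable_on cbox a b" for a b
    by (rule has_integral_integrable[OF has_integral_integral_lebesgue_on[OF Fbox]]) simp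
  have F0: "integral (cbox a b) F = 0" if "cbox a b \<subseteq> \<Omega>" for a b
  proof -
    have "integral (cbox a b) F = integral\<^sup>L (lebesgue_on (cbox a b)) F"
      using Fbox by (simp add: lebesgue_integral_eq_integral)
    also have "\<dots> = (LINT x|lebesgue. indicator (cbox a b) x *\<^sub>R F x)"
      by (simp add: integral_restrict_space)
    also have "\<dots> = (LINT x|lebesgue. indicator \<Omega> x *\<^sub>R (f x * indicator (box a b) x))"
    proof (rule integral_cong_AE)
      have "negligible (cbox a b - box a b)" by (simp add: negligible_frontier_interval)
      then have "AE x in lebesgue. x \<notin> cbox a b - box a b"
        unfolding negligible_iff_null_sets by (rule AE_not_in)
      then show "AE x in lebesgue. indicator (cbox a b) x *\<^sub>R F x
          = indicator \<Omega> x *\<^sub>R (f x * indicator (box a b) x)"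
        using box_subset_cbox[of a b]
        by (auto elim!: eventually_mono simp: F_def indicator_def)
      show "(\<lambda>x. indicator (cbox a b) x *\<^sub>R F x) \<in> borel_measurable lebesgue"
        using F by (intro borel_measurable_scaleR borel_measurable_indicator) auto
      have "(\<lambda>x. indicator (box a b) x *\<^sub>R F x) \<in> borel_measurable lebesgue"
        using F by (intro borel_measurable_scaleR borel_measurable_indicator) auto
      then show "(\<lambda>x. indicator \<Omega> x *\<^sub>R (f x * indicator (box a b) x)) \<in> borel_measurable lebesgue"
        by (simp add: F_def mult_ac)
    qed
    also have "\<dots> = (LINT x|lebesgue_on \<Omega>. f x * indicator (box a b) x)"
      using \<Omega>m by (simp add: integral_restrict_space)
    also have "\<dots> = 0" by (rule integral_box_eq_0[OF \<Omega>m f zero that])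
    finally show ?thesis .
  qed
  obtain N where N: "negligible N" and lim: "\<And>x e. x \<notin> N \<Longrightarrow> 0 < e \<Longrightarrow>
      \<exists>d>0. \<forall>h. 0 < h \<and> h < d \<longrightarrow>
        norm (integral (cbox x (x + h *\<^sub>R One)) F /\<^sub>R h ^ DIM(real^'d) - F x) < e"
    using integrable_ccontinuous_explicit[OF int] by metis
  have "F x = 0" if x: "x \<in> \<Omega>" "x \<notin> N" for x
  proof (rule ccontr)
    assume "F x \<noteq> 0"
    then obtain d where d: "d > 0" and dlim: "\<And>h. 0 < h \<Longrightarrow> h < d \<Longrightarrow>
        norm (integral (cbox x (x + h *\<^sub>R One)) F /\<^sub>R h ^ DIM(real^'d) - F x) < norm (F x)"
      using lim[OF x(2), of "norm (F x)"] by auto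
    obtain r where r: "r > 0" "ball x r \<subseteq> \<Omega>"
      using \<Omega> x openE by blast
    let ?n = "norm (One :: real^'d)"
    have n: "?n > 0" by simp
    \<comment> \<open>a cube of edge \<open>h\<close> has diameter \<open>h * norm One\<close>\<close>
    define h where "h = min (d / 2) (r / (2 * ?n))"
    have h: "0 < h" "h < d" "h * ?n < r"
      using d r n by (auto simp: h_def min_def field_simps)
    have "cbox x (x + h *\<^sub>R One) \<subseteq> ball x r"
    proof
      fix y assume y: "y \<in> cbox x (x + h *\<^sub>R One)"
      then have "norm (y - x) \<le> norm (h *\<^sub>R (One :: real^'d))"
        using h by (intro norm_le_componentwise) (auto simp: mem_box inner_diff_left inner_add_left)
      then show "y \<in> ball x r" using h by (simp add: dist_norm norm_minus_commute)
    qed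
    then show False using F0 dlim[OF h(1,2)] r by auto
  qed
  moreover have "AE x in lebesgue. x \<notin> N"
    using N by (simp add: negligible_iff_null_sets AE_not_in)
  ultimately have "AE x in lebesgue. x \<in> \<Omega> \<longrightarrow> f x = 0"
    by (auto elim!: eventually_mono simp: F_def)
  then show ?thesis using \<Omega>m by (simp add: AE_restrict_space_iff)
qed

section \<open>The Hilbert space of square integrable functions\<close>

lemma L2_iff:
  assumes "\<Omega> \<in> sets lebesgue"
  shows "f \<in> L2 \<Omega> \<longleftrightarrow> f \<in> borel_measurable (lebesgue_on \<Omega>) \<and>
           integrable (lebesgue_on \<Omega>) (\<lambda>x. (norm (f x))\<^sup>2)"
  using assms
  by (simp add: L2_def set_borel_measurable_def set_integrable_def
      borel_measurable_restrict_space_iff integrable_restrict_space)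

lemma L2_inner_eq:
  "\<Omega> \<in> sets lebesgue \<Longrightarrow> L2_inner \<Omega> f g = (LINT x|lebesgue_on \<Omega>. f x \<bullet> g x)"
  by (simp add: L2_inner_def set_lebesgue_integral_def integral_restrict_space)

lemma integrable_L2_inner:
  assumes \<Omega>: "\<Omega> \<in> sets lebesgue" and f: "f \<in> L2 \<Omega>" and g: "g \<in> L2 \<Omega>"
  shows "integrable (lebesgue_on \<Omega>) (\<lambda>x. f x \<bullet> g x)"
proof (rule Bochner_Integration.integrable_bound)
  show "integrable (lebesgue_on \<Omega>) (\<lambda>x. (norm (f x))\<^sup>2 + (norm (g x))\<^sup>2)"
    using \<Omega> f g by (simp add: L2_iff)
  show "(\<lambda>x. f x \<bullet> g x) \<in> borel_measurable (lebesgue_on \<Omega>)"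
    using \<Omega> f g by (intro borel_measurable_inner) (simp_all add: L2_iff)
  show "AE x in lebesgue_on \<Omega>. norm (f x \<bullet> g x) \<le> norm ((norm (f x))\<^sup>2 + (norm (g x))\<^sup>2)"
  proof (rule AE_I2)
    fix x
    have "\<bar>f x \<bullet> g x\<bar> \<le> norm (f x) * norm (g x)" by (rule Cauchy_Schwarz_ineq2)
    also have "\<dots> \<le> (norm (f x))\<^sup>2 + (norm (g x))\<^sup>2"
      using sum_squares_bound[of "norm (f x)" "norm (g x)"]
        mult_nonneg_nonneg[OF norm_ge_zero[of "f x"] norm_ge_zero[of "g x"]]
      unfolding mult.assoc by linarith
    finally show "norm (f x \<bullet> g x) \<le> norm ((norm (f x))\<^sup>2 + (norm (g x))\<^sup>2)" by simp
  qed
qed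

lemma L2_linear:
  fixes T :: "'b::euclidean_space \<Rightarrow> 'c::euclidean_space"
  assumes \<Omega>: "\<Omega> \<in> sets lebesgue" and f: "f \<in> L2 \<Omega>" and T: "linear T"
  shows "(\<lambda>x. T (f x)) \<in> L2 \<Omega>"
proof -
  obtain K where K: "\<And>v. norm (T v) \<le> K * norm v"
    using linear_bounded[OF T] by auto
  have m: "(\<lambda>x. T (f x)) \<in> borel_measurable (lebesgue_on \<Omega>)"
  proof (rule measurable_compose[where f = f and g = T and N = borel])
    show "f \<in> borel_measurable (lebesgue_on \<Omega>)" using f \<Omega> by (simp add: L2_iff)
    show "T \<in> borel_measurable borel"
      using T by (intro borel_measurable_continuous_onI linear_continuous_on)
        (simp add: linear_conv_bounded_linear)
  qed
  have "integrable (lebesgue_on \<Omega>) (\<lambda>x. (norm (T (f x)))\<^sup>2)"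
  proof (rule Bochner_Integration.integrable_bound)
    show "integrable (lebesgue_on \<Omega>) (\<lambda>x. K\<^sup>2 * (norm (f x))\<^sup>2)"
      using f \<Omega> by (simp add: L2_iff)
    show "(\<lambda>x. (norm (T (f x)))\<^sup>2) \<in> borel_measurable (lebesgue_on \<Omega>)"
      using m by measurable
    show "AE x in lebesgue_on \<Omega>. norm ((norm (T (f x)))\<^sup>2) \<le> norm (K\<^sup>2 * (norm (f x))\<^sup>2)"
      by (intro AE_I2) (simp add: power_mult_distrib[symmetric] power_mono[OF K])
  qed
  then show ?thesis using m \<Omega> by (simp add: L2_iff)
qed

lemma L2_scaleR: "\<Omega> \<in> sets lebesgue \<Longrightarrow> f \<in> L2 \<Omega> \<Longrightarrow> (\<lambda>x. c *\<^sub>R f x) \<in> L2 \<Omega>"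
  by (rule L2_linear) (auto intro: linear_scale_self)

lemma L2_add:
  assumes \<Omega>: "\<Omega> \<in> sets lebesgue" and f: "f \<in> L2 \<Omega>" and g: "g \<in> L2 \<Omega>"
  shows "(\<lambda>x. f x + g x) \<in> L2 \<Omega>"
proof -
  have "integrable (lebesgue_on \<Omega>) (\<lambda>x. (norm (f x))\<^sup>2 + (norm (g x))\<^sup>2 + 2 * (f x \<bullet> g x))"
    using f g integrable_L2_inner[OF \<Omega> f g] unfolding L2_iff[OF \<Omega>]
    by (intro Bochner_Integration.integrable_add integrable_mult_right) blast+
  also have "(\<lambda>x. (norm (f x))\<^sup>2 + (norm (g x))\<^sup>2 + 2 * (f x \<bullet> g x)) = (\<lambda>x. (norm (f x + g x))\<^sup>2)"
    by (simp add: power2_norm_eq_inner inner_add inner_commute add_ac)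
  finally show ?thesis
    using f g unfolding L2_iff[OF \<Omega>] by (blast intro: borel_measurable_add)
qed

lemma L2_diff:
  assumes "\<Omega> \<in> sets lebesgue" "f \<in> L2 \<Omega>" "g \<in> L2 \<Omega>"
  shows "(\<lambda>x. f x - g x) \<in> L2 \<Omega>"
  using L2_add[OF assms(1,2) L2_scaleR[OF assms(1,3), of "- 1"]] by simp

lemma L2_sum:
  assumes "\<Omega> \<in> sets lebesgue" "finite I" "\<And>i. i \<in> I \<Longrightarrow> f i \<in> L2 \<Omega>"
  shows "(\<lambda>x. \<Sum>i\<in>I. f i x) \<in> L2 \<Omega>"
  using assms(2,3)
proof (induction I rule: finite_induct)
  case empty
  show ?case using assms(1) by (simp add: L2_iff)
next
  case (insert i I)
  then show ?case using L2_add[OF assms(1), of "f i" "\<lambda>x. \<Sum>i\<in>I. f i x"] by simp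
qed

lemma lebesgue_on_finite_measure: "open \<Omega> \<Longrightarrow> bounded \<Omega> \<Longrightarrow> finite_measure (lebesgue_on \<Omega>)"
  by (rule finite_measure_lebesgue_on) (simp add: lmeasurable_open)

lemma L2_if_AE_bounded:
  assumes \<Omega>: "open \<Omega>" "bounded \<Omega>"
    and f: "f \<in> borel_measurable (lebesgue_on \<Omega>)"
    and B: "AE x in lebesgue_on \<Omega>. norm (f x) \<le> B"
  shows "f \<in> L2 \<Omega>"
proof -
  interpret finite_measure "lebesgue_on \<Omega>" by (rule lebesgue_on_finite_measure[OF \<Omega>])
  have "AE x in lebesgue_on \<Omega>. norm ((norm (f x))\<^sup>2) \<le> B\<^sup>2"
    using B by eventually_elim (simp add: power_mono)
  then have "integrable (lebesgue_on \<Omega>) (\<lambda>x. (norm (f x))\<^sup>2)"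
    by (rule integrable_const_bound) (use f in measurable)
  then show ?thesis using f \<Omega> by (simp add: L2_iff)
qed

lemma L2_imp_integrable:
  fixes f :: "_ \<Rightarrow> real"
  assumes \<Omega>: "open \<Omega>" "bounded \<Omega>" and f: "f \<in> L2 \<Omega>"
  shows "integrable (lebesgue_on \<Omega>) f"
proof -
  have "(\<lambda>x. 1::real) \<in> L2 \<Omega>"
    by (rule L2_if_AE_bounded[OF \<Omega>, where B = 1]) auto
  from integrable_L2_inner[OF _ f this] show ?thesis using \<Omega> by simp
qed

lemma L2_continuous:
  assumes \<Omega>: "open \<Omega>" "bounded \<Omega>" and f: "continuous_on UNIV f"
  shows "f \<in> L2 \<Omega>"
proof -
  have "compact (f ` closure \<Omega>)"
    using \<Omega> f by (intro compact_continuous_image) (auto intro: continuous_on_subset)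
  then obtain B where B: "\<forall>y\<in>f ` closure \<Omega>. norm y \<le> B"
    using compact_imp_bounded bounded_iff by metis
  have "AE x in lebesgue_on \<Omega>. norm (f x) \<le> B"
  proof (rule AE_I2)
    fix x assume "x \<in> space (lebesgue_on \<Omega>)"
    then show "norm (f x) \<le> B" using B closure_subset[of \<Omega>] by auto
  qed
  moreover have "f \<in> borel_measurable (lebesgue_on \<Omega>)"
    using \<Omega> f continuous_on_subset[OF f subset_UNIV]
    by (intro continuous_imp_measurable_on_sets_lebesgue) auto
  ultimately show ?thesis using L2_if_AE_bounded[OF \<Omega>] by blast
qed

lemma L2_inner_cong_AE:
  assumes \<Omega>: "\<Omega> \<in> sets lebesgue"
    and L2: "f \<in> L2 \<Omega>" "g \<in> L2 \<Omega>" "f' \<in> L2 \<Omega>" "g' \<in> L2 \<Omega>"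
    and eq: "AE x in lebesgue_on \<Omega>. f x = f' x" "AE x in lebesgue_on \<Omega>. g x = g' x"
  shows "L2_inner \<Omega> f g = L2_inner \<Omega> f' g'"
proof -
  have "AE x in lebesgue_on \<Omega>. f x \<bullet> g x = f' x \<bullet> g' x"
    using eq by eventually_elim simp
  then show ?thesis
    unfolding L2_inner_eq[OF \<Omega>]
    by (intro integral_cong_AE borel_measurable_integrable integrable_L2_inner[OF \<Omega>] L2)
qed

lemma inner_product_on_L2:
  assumes \<Omega>: "\<Omega> \<in> sets lebesgue"
  shows "inner_product_on \<Omega> (L2 \<Omega> :: (real^'d::finite \<Rightarrow> 'b::euclidean_space) set) (L2_inner \<Omega>)"
  unfolding inner_product_on_def
proof (intro conjI ballI allI impI)
  note int = integrable_L2_inner[OF \<Omega>] and eq = L2_inner_eq[OF \<Omega>]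
  fix e w :: "real^'d \<Rightarrow> 'b" assume e: "e \<in> L2 \<Omega>" and w: "w \<in> L2 \<Omega>"
  show "L2_inner \<Omega> e w = L2_inner \<Omega> w e" by (simp add: eq inner_commute)
  show "L2_inner \<Omega> (\<lambda>x. c *\<^sub>R e x) w = c * L2_inner \<Omega> e w" for c by (simp add: eq)
  fix e' :: "real^'d \<Rightarrow> 'b" assume e': "e' \<in> L2 \<Omega>"
  show "L2_inner \<Omega> (\<lambda>x. e x + e' x) w = L2_inner \<Omega> e w + L2_inner \<Omega> e' w"
    using int[OF e w] int[OF e' w] by (simp add: eq inner_add_left)
next
  fix e :: "real^'d \<Rightarrow> 'b" assume e: "e \<in> L2 \<Omega>"
  show "L2_inner \<Omega> e e \<ge> 0" by (simp add: L2_inner_eq[OF \<Omega>] integral_nonneg_AE)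
  assume "L2_inner \<Omega> e e = 0"
  then have "AE x in lebesgue_on \<Omega>. e x \<bullet> e x = 0"
    using integral_nonneg_eq_0_iff_AE[OF integrable_L2_inner[OF \<Omega> e e]]
    by (simp add: L2_inner_eq[OF \<Omega>])
  then show "AE x in lebesgue. x \<in> \<Omega> \<longrightarrow> e x = 0" using \<Omega> by (simp add: AE_restrict_space_iff)
qed

lemma inner_product_onD:
  assumes "inner_product_on \<Omega> S a" "e \<in> S"
  shows inner_product_on_commute: "w \<in> S \<Longrightarrow> a e w = a w e"
    and inner_product_on_add: "e' \<in> S \<Longrightarrow> w \<in> S \<Longrightarrow> a (\<lambda>x. e x + e' x) w = a e w + a e' w"
    and inner_product_on_scaleR: "w \<in> S \<Longrightarrow> a (\<lambda>x. c *\<^sub>R e x) w = c * a e w"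
    and inner_product_on_nonneg: "a e e \<ge> 0"
  using assms unfolding inner_product_on_def by blast+

lemma inner_product_on_diff_right:
  assumes a: "inner_product_on \<Omega> S a"
    and add: "\<And>e w. e \<in> S \<Longrightarrow> w \<in> S \<Longrightarrow> (\<lambda>x. e x + w x) \<in> S"
    and scale: "\<And>c e. e \<in> S \<Longrightarrow> (\<lambda>x. c *\<^sub>R e x) \<in> S"
    and S: "e \<in> S" "w \<in> S" "w' \<in> S"
  shows "a e (\<lambda>x. w x - w' x) = a e w - a e w'"
proof -
  have m: "(\<lambda>x. - 1 *\<^sub>R w' x) \<in> S" by (rule scale[OF S(3)])
  have d: "(\<lambda>x. w x + - 1 *\<^sub>R w' x) \<in> S" by (rule add[OF S(2) m])
  have "a e (\<lambda>x. w x + - 1 *\<^sub>R w' x) = a (\<lambda>x. w x + - 1 *\<^sub>R w' x) e"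
    by (rule inner_product_on_commute[OF a S(1) d])
  also have "\<dots> = a w e + a (\<lambda>x. - 1 *\<^sub>R w' x) e"
    by (rule inner_product_on_add[OF a S(2) m S(1)])
  also have "a (\<lambda>x. - 1 *\<^sub>R w' x) e = - 1 * a w' e"
    by (rule inner_product_on_scaleR[OF a S(3,1)])
  also have "a w e = a e w" by (rule inner_product_on_commute[OF a S(2,1)])
  also have "a w' e = a e w'" by (rule inner_product_on_commute[OF a S(3,1)])
  finally show ?thesis by simp
qed

text \<open>
  The expansion of \<open>a (e - e') (e - e') \<ge> 0\<close>: the graph of the quadratic form \<open>a e e / 2\<close> lies above
  its tangent at \<open>e\<close>. It serves both the gradient energy and the elastic energy.
\<close>

lemma inner_product_on_convex:
  assumes a: "inner_product_on \<Omega> S a"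
    and add: "\<And>e w. e \<in> S \<Longrightarrow> w \<in> S \<Longrightarrow> (\<lambda>x. e x + w x) \<in> S"
    and scale: "\<And>c e. e \<in> S \<Longrightarrow> (\<lambda>x. c *\<^sub>R e x) \<in> S"
    and S: "e \<in> S" "e' \<in> S"
  shows "a e e / 2 - a e' e' / 2 \<le> a e (\<lambda>x. e x - e' x)"
proof -
  let ?d = "\<lambda>x. e x - e' x"
  have d: "?d \<in> S" using add[OF S(1) scale[OF S(2), of "- 1"]] by simp
  have diff: "a w ?d = a w e - a w e'" if "w \<in> S" for w
    by (rule inner_product_on_diff_right[OF a add scale that S])
  have "0 \<le> a ?d ?d" by (rule inner_product_on_nonneg[OF a d])
  also have "a ?d ?d = a e ?d - a e' ?d"
    using diff[OF d] inner_product_on_commute[OF a d] S by simp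
  finally show ?thesis
    using diff[OF S(1)] diff[OF S(2)] inner_product_on_commute[OF a S] by simp
qed

lemma L2_inner_convex:
  assumes \<Omega>: "\<Omega> \<in> sets lebesgue" and "f \<in> L2 \<Omega>" "g \<in> L2 \<Omega>"
  shows "L2_inner \<Omega> f f / 2 - L2_inner \<Omega> g g / 2 \<le> L2_inner \<Omega> f (\<lambda>x. f x - g x)"
  by (rule inner_product_on_convex[OF inner_product_on_L2[OF \<Omega>] _ _ assms(2,3)])
     (blast intro: L2_add[OF \<Omega>] L2_scaleR[OF \<Omega>])+

section \<open>Weak gradients\<close>

lemma is_weak_gradient_iff:
  "is_weak_gradient \<Omega> f g \<longleftrightarrow>
     (\<forall>\<eta>. test_function \<Omega> \<eta> \<longrightarrow>
        (\<forall>i. L2_inner \<Omega> f (partial_deriv i \<eta>) = - L2_inner \<Omega> (\<lambda>x. g x $ i) \<eta>))"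
  by (simp only: is_weak_gradient_def L2_inner_def inner_real_def)

lemma L2_vec_nth:
  fixes g :: "real^'d::finite \<Rightarrow> real^'d"
  shows "\<Omega> \<in> sets lebesgue \<Longrightarrow> g \<in> L2 \<Omega> \<Longrightarrow> (\<lambda>x. g x $ i) \<in> L2 \<Omega>"
  by (rule L2_linear[OF _ _ bounded_linear.linear[OF bounded_linear_vec_nth]])

lemma L2_inner_diff_left:
  assumes \<Omega>: "\<Omega> \<in> sets lebesgue" and L2: "f \<in> L2 \<Omega>" "g \<in> L2 \<Omega>" "h \<in> L2 \<Omega>"
  shows "L2_inner \<Omega> (\<lambda>x. f x - g x) h = L2_inner \<Omega> f h - L2_inner \<Omega> g h"
  using integrable_L2_inner[OF \<Omega> L2(1,3)] integrable_L2_inner[OF \<Omega> L2(2,3)]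
  unfolding L2_inner_eq[OF \<Omega>] inner_diff_left by (rule Bochner_Integration.integral_diff)

lemma test_function_L2:
  assumes "open \<Omega>" "bounded \<Omega>" "test_function \<Omega> \<eta>"
  shows "\<eta> \<in> L2 \<Omega>" "partial_deriv i \<eta> \<in> L2 \<Omega>"
proof -
  have "C_k 0 \<eta>" "C_k (Suc 0) \<eta>" using assms(3) unfolding test_function_def by blast+
  then have "continuous_on UNIV \<eta>" "continuous_on UNIV (partial_deriv i \<eta>)" by simp_all
  then show "\<eta> \<in> L2 \<Omega>" "partial_deriv i \<eta> \<in> L2 \<Omega>"
    by (simp_all add: L2_continuous[OF assms(1,2)])
qed

lemma is_weak_gradient_diff:
  assumes \<Omega>: "open \<Omega>" "bounded \<Omega>"
    and L2: "f \<in> L2 \<Omega>" "g \<in> L2 \<Omega>" "df \<in> L2 \<Omega>" "dg \<in> L2 \<Omega>"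
    and w: "is_weak_gradient \<Omega> f df" "is_weak_gradient \<Omega> g dg"
  shows "is_weak_gradient \<Omega> (\<lambda>x. f x - g x) (\<lambda>x. df x - dg x)"
  unfolding is_weak_gradient_iff
proof (intro allI impI)
  fix \<eta> i assume t: "test_function \<Omega> \<eta>"
  have \<Omega>m: "\<Omega> \<in> sets lebesgue" using \<Omega> by auto
  have "L2_inner \<Omega> f (partial_deriv i \<eta>) = - L2_inner \<Omega> (\<lambda>x. df x $ i) \<eta>"
    and "L2_inner \<Omega> g (partial_deriv i \<eta>) = - L2_inner \<Omega> (\<lambda>x. dg x $ i) \<eta>"
    using w t by (simp_all add: is_weak_gradient_iff)
  then show "L2_inner \<Omega> (\<lambda>x. f x - g x) (partial_deriv i \<eta>)
      = - L2_inner \<Omega> (\<lambda>x. (df x - dg x) $ i) \<eta>"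
    using L2_inner_diff_left[OF \<Omega>m L2(1,2) test_function_L2(2)[OF \<Omega> t]]
      L2_inner_diff_left[OF \<Omega>m L2_vec_nth[OF \<Omega>m L2(3)] L2_vec_nth[OF \<Omega>m L2(4)]
        test_function_L2(1)[OF \<Omega> t]]
    by simp
qed

text \<open>
  The components of the difference of two weak gradients integrate to zero against every test function.
\<close>

lemma is_weak_gradient_unique:
  assumes \<Omega>: "open \<Omega>" "bounded \<Omega>" and L2: "g \<in> L2 \<Omega>" "g' \<in> L2 \<Omega>"
    and w: "is_weak_gradient \<Omega> f g" "is_weak_gradient \<Omega> f g'"
  shows "AE x in lebesgue_on \<Omega>. g x = g' x"
proof -
  have \<Omega>m: "\<Omega> \<in> sets lebesgue" using \<Omega> by auto
  have "AE x in lebesgue_on \<Omega>. g x $ i - g' x $ i = 0" for i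
  proof (rule AE_eq_0_if_test_integrals_vanish[OF \<Omega>(1)])
    show "integrable (lebesgue_on \<Omega>) (\<lambda>x. g x $ i - g' x $ i)"
      by (intro L2_imp_integrable[OF \<Omega>] L2_diff L2_vec_nth \<Omega>m L2)
    fix \<eta> assume t: "test_function \<Omega> \<eta>"
    have "L2_inner \<Omega> (\<lambda>x. g x $ i) \<eta> = L2_inner \<Omega> (\<lambda>x. g' x $ i) \<eta>"
      using w t unfolding is_weak_gradient_iff by (metis neg_equal_iff_equal)
    then have "L2_inner \<Omega> (\<lambda>x. g x $ i - g' x $ i) \<eta> = 0"
      using L2_inner_diff_left[OF \<Omega>m L2_vec_nth[OF \<Omega>m L2(1)] L2_vec_nth[OF \<Omega>m L2(2)]
          test_function_L2(1)[OF \<Omega> t]] by simp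
    then show "(LINT x|lebesgue_on \<Omega>. (g x $ i - g' x $ i) * \<eta> x) = 0"
      by (simp add: L2_inner_eq[OF \<Omega>m])
  qed
  then have "AE x in lebesgue_on \<Omega>. \<forall>i\<in>UNIV. g x $ i - g' x $ i = 0"
    by (intro AE_finite_allI) auto
  then show ?thesis by eventually_elim (simp add: vec_eq_iff)
qed

lemma
  assumes "f \<in> H1 \<Omega>"
  shows grad_L2: "grad \<Omega> f \<in> L2 \<Omega>"
    and is_weak_gradient_grad: "is_weak_gradient \<Omega> f (grad \<Omega> f)"
  using assms someI_ex[of "\<lambda>g. g \<in> L2 \<Omega> \<and> is_weak_gradient \<Omega> f g"]
  by (auto simp: H1_def grad_def)

lemma H1_imp_L2: "f \<in> H1 \<Omega> \<Longrightarrow> f \<in> L2 \<Omega>"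
  by (simp add: H1_def)

lemma
  assumes \<Omega>: "open \<Omega>" "bounded \<Omega>" and f: "f \<in> H1 \<Omega>" and g: "g \<in> H1 \<Omega>"
  shows H1_diff: "(\<lambda>x. f x - g x) \<in> H1 \<Omega>"
    and grad_diff: "AE x in lebesgue_on \<Omega>. grad \<Omega> (\<lambda>x. f x - g x) x = grad \<Omega> f x - grad \<Omega> g x"
proof -
  have \<Omega>m: "\<Omega> \<in> sets lebesgue" using \<Omega> by auto
  note fg = f[THEN H1_imp_L2] g[THEN H1_imp_L2] f[THEN grad_L2] g[THEN grad_L2]
  have d: "(\<lambda>x. grad \<Omega> f x - grad \<Omega> g x) \<in> L2 \<Omega>" by (intro L2_diff fg \<Omega>m)
  have w: "is_weak_gradient \<Omega> (\<lambda>x. f x - g x) (\<lambda>x. grad \<Omega> f x - grad \<Omega> g x)"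
    by (intro is_weak_gradient_diff \<Omega> fg f g is_weak_gradient_grad)
  show H: "(\<lambda>x. f x - g x) \<in> H1 \<Omega>"
    using d w L2_diff[OF \<Omega>m fg(1,2)] by (auto simp: H1_def)
  show "AE x in lebesgue_on \<Omega>. grad \<Omega> (\<lambda>x. f x - g x) x = grad \<Omega> f x - grad \<Omega> g x"
    by (rule is_weak_gradient_unique[OF \<Omega> grad_L2[OF H] d is_weak_gradient_grad[OF H] w])
qed

section \<open>Boundedness of finite element functions\<close>

lemma fe_space_diff:
  assumes F: "fe_space \<Omega> F" and f: "f \<in> F" and g: "g \<in> F"
  shows "(\<lambda>x. f x - g x) \<in> F"
proof -
  obtain B where B: "F = {f. \<exists>c. f = (\<lambda>x. \<Sum>b\<in>B. c b *\<^sub>R b x)}"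
    using F by (auto simp: fe_space_def)
  obtain c c' where "f = (\<lambda>x. \<Sum>b\<in>B. c b *\<^sub>R b x)" "g = (\<lambda>x. \<Sum>b\<in>B. c' b *\<^sub>R b x)"
    using f g B by auto
  then have "(\<lambda>x. f x - g x) = (\<lambda>x. \<Sum>b\<in>B. (c b - c' b) *\<^sub>R b x)"
    by (auto simp: sum_subtractf scaleR_diff_left)
  then show ?thesis unfolding B by (intro CollectI exI[of _ "\<lambda>b. c b - c' b"])
qed

text \<open>
  On each of the finitely many bounded cells the function agrees with a polynomial, and the cells
  exhaust \<open>\<Omega>\<close> up to their frontiers, which are null sets. Since no other values of \<open>f\<close> are controlled,
  the bound only holds almost everywhere.
\<close>

lemma fe_space_AE_bounded:
  assumes \<Omega>: "open \<Omega>" "bounded \<Omega>" and F: "fe_space \<Omega> F" and f: "f \<in> F"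
  obtains B where "AE x in lebesgue_on \<Omega>. norm (f x) \<le> B"
proof -
  obtain \<T> where \<T>: "mesh \<Omega> \<T>"
    and poly: "\<And>K. K \<in> \<T> \<Longrightarrow> \<exists>p. polynomial_function p \<and> (\<forall>x\<in>K. f x = p x)"
    using F[unfolded fe_space_def, THEN conjunct2] f by blast
  have "\<exists>B. \<forall>x\<in>K. norm (f x) \<le> B" if K: "K \<in> \<T>" for K
  proof -
    obtain p where p: "polynomial_function p" "\<forall>x\<in>K. f x = p x" using poly[OF K] by blast
    have "bounded K" using \<T> K \<Omega> by (auto simp: mesh_def intro: bounded_subset)
    then have "bounded (p ` closure K)"
      by (intro compact_imp_bounded compact_continuous_image continuous_on_polymonial_function p)
         simp
    then show ?thesis using p(2) closure_subset[of K] by (force simp: bounded_iff)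
  qed
  then obtain b where b: "\<And>K x. K \<in> \<T> \<Longrightarrow> x \<in> K \<Longrightarrow> norm (f x) \<le> b K" by metis
  have fin: "finite \<T>" using \<T> by (simp add: mesh_def)
  have "negligible (\<Union>K\<in>\<T>. frontier K)"
    using \<T> fin by (intro negligible_Union) (auto simp: mesh_def)
  then have "AE x in lebesgue. x \<notin> (\<Union>K\<in>\<T>. frontier K)"
    unfolding negligible_iff_null_sets by (rule AE_not_in)
  then have "AE x in lebesgue. x \<in> \<Omega> \<longrightarrow> norm (f x) \<le> (\<Sum>K\<in>\<T>. \<bar>b K\<bar>)"
  proof eventually_elim
    case (elim x)
    show ?case
    proof
      assume "x \<in> \<Omega>"
      then have "x \<in> closure \<Omega>" using closure_subset by blast
      then have "x \<in> (\<Union>K\<in>\<T>. closure K)" using \<T> by (simp add: mesh_def)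
      then obtain K where K: "K \<in> \<T>" "x \<in> closure K" by blast
      then have "x \<in> K" using elim interior_subset by (auto simp: frontier_def)
      then have "norm (f x) \<le> b K" using b K by blast
      also have "\<dots> \<le> \<bar>b K\<bar>" by simp
      also have "\<dots> \<le> (\<Sum>K\<in>\<T>. \<bar>b K\<bar>)" using fin K by (intro member_le_sum) auto
      finally show "norm (f x) \<le> (\<Sum>K\<in>\<T>. \<bar>b K\<bar>)" .
    qed
  qed
  then show ?thesis using \<Omega> that by (simp add: AE_restrict_space_iff)
qed

text \<open>
  Composition with a nonlinear function keeps square integrability without any growth condition,
  because finite element functions are essentially bounded.
\<close>

lemma L2_compose_bounded:
  fixes f :: "real^'d::finite \<Rightarrow> real" and g :: "real \<Rightarrow> real"
  assumes \<Omega>: "open \<Omega>" "bounded \<Omega>" and F: "fe_space \<Omega> F" and f: "f \<in> F" "f \<in> L2 \<Omega>"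
    and g: "g \<in> borel_measurable borel" and bnd: "\<And>B. \<exists>M. \<forall>t. \<bar>t\<bar> \<le> B \<longrightarrow> \<bar>g t\<bar> \<le> M"
  shows "(\<lambda>x. g (f x)) \<in> L2 \<Omega>"
proof -
  obtain B where B: "AE x in lebesgue_on \<Omega>. norm (f x) \<le> B"
    using fe_space_AE_bounded[OF \<Omega> F f(1)] .
  obtain M where M: "\<forall>t. \<bar>t\<bar> \<le> B \<longrightarrow> \<bar>g t\<bar> \<le> M" using bnd by blast
  have "(\<lambda>x. g (f x)) \<in> borel_measurable (lebesgue_on \<Omega>)"
    using measurable_compose[OF _ g] f(2) \<Omega> by (auto simp: L2_iff)
  moreover have "AE x in lebesgue_on \<Omega>. norm (g (f x)) \<le> M"
    using B by eventually_elim (simp add: M)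
  ultimately show ?thesis using L2_if_AE_bounded[OF \<Omega>] by blast
qed

section \<open>Convex functions of one variable\<close>

lemma convex_above_tangent:
  fixes f :: "real \<Rightarrow> real"
  assumes "convex_on UNIV f" "f differentiable_on UNIV"
  shows "deriv f a * (b - a) \<le> f b - f a"
proof -
  have "(f has_field_derivative deriv f a) (at a)"
    using assms(2) by (simp add: differentiable_on_def DERIV_deriv_iff_real_differentiable)
  then show ?thesis
    by (intro convex_on_imp_above_tangent[OF assms(1)]) simp_all
qed

lemma mono_deriv_convex:
  fixes f :: "real \<Rightarrow> real"
  assumes "convex_on UNIV f" "f differentiable_on UNIV"
  shows "mono (deriv f)"
proof (rule monoI)
  fix a b :: real assume "a \<le> b"
  have "0 \<le> (deriv f b - deriv f a) * (b - a)"
    using convex_above_tangent[OF assms, of a b] convex_above_tangent[OF assms, of b a]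
    by (simp add: algebra_simps)
  then show "deriv f a \<le> deriv f b" using \<open>a \<le> b\<close>
    by (cases "a = b") (auto simp: zero_le_mult_iff)
qed

lemma mono_locally_bounded:
  fixes g :: "real \<Rightarrow> real"
  assumes "mono g"
  shows "\<exists>M. \<forall>t. \<bar>t\<bar> \<le> B \<longrightarrow> \<bar>g t\<bar> \<le> M"
proof (intro exI[of _ "\<bar>g B\<bar> + \<bar>g (- B)\<bar>"] allI impI)
  fix t :: real assume "\<bar>t\<bar> \<le> B"
  then have "- B \<le> t" "t \<le> B" by linarith+
  then have "g (- B) \<le> g t" "g t \<le> g B" using monoD[OF assms] by blast+
  then show "\<bar>g t\<bar> \<le> \<bar>g B\<bar> + \<bar>g (- B)\<bar>" by linarith
qed

lemma continuous_locally_bounded: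
  fixes g :: "real \<Rightarrow> real"
  assumes "continuous_on UNIV g"
  shows "\<exists>M. \<forall>t. \<bar>t\<bar> \<le> B \<longrightarrow> \<bar>g t\<bar> \<le> M"
proof -
  have "bounded (g ` {- B..B})"
    using assms by (intro compact_imp_bounded compact_continuous_image)
      (auto intro: continuous_on_subset)
  then obtain M where "\<forall>t\<in>{- B..B}. \<bar>g t\<bar> \<le> M" unfolding bounded_iff by auto
  then have "\<bar>g t\<bar> \<le> M" if "\<bar>t\<bar> \<le> B" for t using that by (simp add: abs_le_iff)
  then show ?thesis by blast
qed

text \<open>
  The discrete chain rule behind convex splitting. The convex \<open>\<Psi>c\<close> is estimated by its tangent at \<open>a\<close>,
  where the scheme is implicit, and \<open>\<Psi>e\<close>, which enters with a minus sign, by its tangent at \<open>b\<close>.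
\<close>

lemma double_well_split_le:
  assumes "double_well_split \<Psi> \<Psi>c \<Psi>e L"
  shows "\<Psi> a - \<Psi> b \<le> (deriv \<Psi>c a - deriv \<Psi>e b) * (a - b)"
proof -
  have "deriv \<Psi>c a * (b - a) \<le> \<Psi>c b - \<Psi>c a" "deriv \<Psi>e b * (a - b) \<le> \<Psi>e a - \<Psi>e b"
    using assms by (auto intro!: convex_above_tangent simp: double_well_split_def)
  moreover have "\<Psi> a = \<Psi>c a - \<Psi>e a" "\<Psi> b = \<Psi>c b - \<Psi>e b"
    using assms unfolding double_well_split_def by blast+
  ultimately show ?thesis by (simp add: algebra_simps)
qed

lemma
  assumes \<Omega>: "open \<Omega>" "bounded \<Omega>" and F: "fe_space \<Omega> F" and f: "f \<in> F" "f \<in> L2 \<Omega>"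
    and \<Psi>: "double_well_split \<Psi> \<Psi>c \<Psi>e L"
  shows L2_potential: "(\<lambda>x. \<Psi> (f x)) \<in> L2 \<Omega>"
    and L2_deriv_potential: "(\<lambda>x. deriv \<Psi>c (f x)) \<in> L2 \<Omega>" "(\<lambda>x. deriv \<Psi>e (f x)) \<in> L2 \<Omega>"
proof -
  have [simp]: "\<Psi> = (\<lambda>s. \<Psi>c s - \<Psi>e s)" using \<Psi> by (auto simp: double_well_split_def)
  have "continuous_on UNIV \<Psi>"
    using \<Psi> by (auto simp: double_well_split_def intro!: continuous_on_diff differentiable_imp_continuous_on)
  then show "(\<lambda>x. \<Psi> (f x)) \<in> L2 \<Omega>"
    by (intro L2_compose_bounded[OF \<Omega> F f] borel_measurable_continuous_onI continuous_locally_bounded)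
  have deriv_L2: "(\<lambda>x. deriv h (f x)) \<in> L2 \<Omega>"
    if h: "convex_on UNIV h" "h differentiable_on UNIV" for h
  proof (rule L2_compose_bounded[OF \<Omega> F f])
    show "deriv h \<in> borel_measurable borel"
      by (rule borel_measurable_mono[OF mono_deriv_convex[OF h]])
    show "\<exists>M. \<forall>t. \<bar>t\<bar> \<le> B \<longrightarrow> \<bar>deriv h t\<bar> \<le> M" for B
      by (rule mono_locally_bounded[OF mono_deriv_convex[OF h]])
  qed
  show "(\<lambda>x. deriv \<Psi>c (f x)) \<in> L2 \<Omega>"
    by (rule deriv_L2) (use \<Psi> in \<open>simp_all add: double_well_split_def\<close>)
  show "(\<lambda>x. deriv \<Psi>e (f x)) \<in> L2 \<Omega>"
    by (rule deriv_L2) (use \<Psi> in \<open>simp_all add: double_well_split_def\<close>)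
qed

section \<open>Strains\<close>

lemma linear_transpose: "linear (transpose :: real^'d^'d \<Rightarrow> real^'d^'d)"
  unfolding transpose_def by (rule linearI) (vector, vector)

lemma linear_tensor_apply: "linear (tensor_apply C)"
proof (rule linearI)
  show "tensor_apply C (x + y) = tensor_apply C x + tensor_apply C y" for x y
    by (simp add: tensor_apply_def vec_eq_iff distrib_left sum.distrib)
  show "tensor_apply C (c *\<^sub>R x) = c *\<^sub>R tensor_apply C x" for c x
    by (simp add: tensor_apply_def vec_eq_iff sum_distrib_left mult.left_commute)
qed

text \<open>
  The vector gradient is a sum of linear images of the gradients of the components, so closure of
  square integrable functions under linear maps and sums applies.
\<close>

lemma vgrad_L2:
  assumes \<Omega>: "\<Omega> \<in> sets lebesgue" and u: "\<And>i. (\<lambda>x. u x $ i) \<in> H1 \<Omega>"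
  shows "vgrad \<Omega> u \<in> L2 \<Omega>"
proof -
  \<comment> \<open>\<open>T i\<close> places a vector in row \<open>i\<close> of a matrix\<close>
  define T :: "'a \<Rightarrow> real^'a \<Rightarrow> real^'a^'a" where "T i v = (\<chi> k. if k = i then v else 0)" for i v
  have T: "linear (T i)" for i by (rule linearI) (auto simp: T_def vec_eq_iff)
  have "vgrad \<Omega> u = (\<lambda>x. \<Sum>i\<in>UNIV. T i (grad \<Omega> (\<lambda>y. u y $ i) x))"
    by (auto simp: vgrad_def T_def vec_eq_iff if_distrib[of "\<lambda>v. v $ _"] cong: if_cong)
  also have "\<dots> \<in> L2 \<Omega>"
    by (rule L2_sum[OF \<Omega>]) (simp_all add: L2_linear[OF \<Omega> grad_L2[OF u] T])
  finally show ?thesis .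
qed

lemma strain_sym_L2:
  assumes \<Omega>: "\<Omega> \<in> sets lebesgue" and u: "\<And>i. (\<lambda>x. u x $ i) \<in> H1 \<Omega>"
  shows "strain \<Omega> u \<in> sym_L2 \<Omega>"
proof -
  have "(\<lambda>x. (1/2) *\<^sub>R (vgrad \<Omega> u x + transpose (vgrad \<Omega> u x))) \<in> L2 \<Omega>"
    using vgrad_L2[OF assms] by (intro L2_scaleR L2_add L2_linear[OF \<Omega> _ linear_transpose] \<Omega>)
  moreover have "strain \<Omega> u = (\<lambda>x. (1/2) *\<^sub>R (vgrad \<Omega> u x + transpose (vgrad \<Omega> u x)))"
    by (rule ext) (simp add: strain_def)
  moreover have "transpose (strain \<Omega> u x) = strain \<Omega> u x" for x
    by (simp add: strain_def transpose_def vec_eq_iff)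
  ultimately show ?thesis by (simp add: sym_L2_def)
qed

lemma sym_L2_scaleR: "\<Omega> \<in> sets lebesgue \<Longrightarrow> e \<in> sym_L2 \<Omega> \<Longrightarrow> (\<lambda>x. c *\<^sub>R e x) \<in> sym_L2 \<Omega>"
  by (simp add: sym_L2_def L2_scaleR linear_scale[OF linear_transpose])

lemma sym_L2_add:
  "\<Omega> \<in> sets lebesgue \<Longrightarrow> e \<in> sym_L2 \<Omega> \<Longrightarrow> w \<in> sym_L2 \<Omega> \<Longrightarrow> (\<lambda>x. e x + w x) \<in> sym_L2 \<Omega>"
  by (simp add: sym_L2_def L2_add linear_add[OF linear_transpose])

lemma sym_L2_diff:
  "\<Omega> \<in> sets lebesgue \<Longrightarrow> e \<in> sym_L2 \<Omega> \<Longrightarrow> w \<in> sym_L2 \<Omega> \<Longrightarrow> (\<lambda>x. e x - w x) \<in> sym_L2 \<Omega>"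
  by (simp add: sym_L2_def L2_diff linear_diff[OF linear_transpose])

lemma spherical_sym_L2:
  assumes \<Omega>: "\<Omega> \<in> sets lebesgue" and \<phi>: "\<phi> \<in> L2 \<Omega>"
  shows "(\<lambda>x. (\<phi> x * \<xi>) *\<^sub>R mat 1) \<in> sym_L2 \<Omega>"
proof -
  have "linear (\<lambda>s. (s * \<xi>) *\<^sub>R (mat 1 :: real^'a^'a))"
    by (rule linearI) (simp_all add: algebra_simps)
  from L2_linear[OF \<Omega> \<phi> this] show ?thesis
    by (simp add: sym_L2_def linear_scale[OF linear_transpose])
qed

lemma elastic_strain_sym_L2:
  assumes \<Omega>: "\<Omega> \<in> sets lebesgue" and \<phi>: "\<phi> \<in> L2 \<Omega>" and u: "\<And>i. (\<lambda>x. u x $ i) \<in> H1 \<Omega>"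
  shows "elastic_strain \<Omega> \<xi> \<phi> u \<in> sym_L2 \<Omega>"
  using sym_L2_diff[OF \<Omega> strain_sym_L2[OF \<Omega> u] spherical_sym_L2[OF \<Omega> \<phi>, of \<xi>]]
  by (simp add: elastic_strain_def[abs_def] mult.commute)

lemma strain_diff:
  assumes \<Omega>: "open \<Omega>" "bounded \<Omega>"
    and u: "\<And>i. (\<lambda>x. u x $ i) \<in> H1 \<Omega>" and v: "\<And>i. (\<lambda>x. v x $ i) \<in> H1 \<Omega>"
  shows "AE x in lebesgue_on \<Omega>. strain \<Omega> (\<lambda>x. u x - v x) x = strain \<Omega> u x - strain \<Omega> v x"
proof -
  have "AE x in lebesgue_on \<Omega>. \<forall>i\<in>UNIV. grad \<Omega> (\<lambda>y. u y $ i - v y $ i) x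
      = grad \<Omega> (\<lambda>y. u y $ i) x - grad \<Omega> (\<lambda>y. v y $ i) x"
    by (intro AE_finite_allI grad_diff[OF \<Omega> u v]) simp
  then show ?thesis
  proof eventually_elim
    case (elim x)
    have "vgrad \<Omega> (\<lambda>y. u y - v y) x = vgrad \<Omega> u x - vgrad \<Omega> v x"
      using elim by (simp add: vgrad_def vec_eq_iff)
    then show ?case
      by (simp add: strain_def linear_diff[OF linear_transpose] scaleR_add_right scaleR_diff_right)
  qed
qed

text \<open>
  The left side is the combination of test functions that arises from the chemical potential and the
  equilibrium equation; it equals the increment of the elastic strain only almost everywhere, since
  gradients are chosen representatives.
\<close>

lemma elastic_strain_diff:
  assumes \<Omega>: "open \<Omega>" "bounded \<Omega>"
    and u: "\<And>i. (\<lambda>x. u x $ i) \<in> H1 \<Omega>" and v: "\<And>i. (\<lambda>x. v x $ i) \<in> H1 \<Omega>"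
  shows "AE x in lebesgue_on \<Omega>.
           strain \<Omega> (\<lambda>x. u x - v x) x - ((\<phi> x - \<psi> x) * \<xi>) *\<^sub>R mat 1
           = elastic_strain \<Omega> \<xi> \<phi> u x - elastic_strain \<Omega> \<xi> \<psi> v x"
  using strain_diff[OF assms]
  by eventually_elim (simp add: elastic_strain_def algebra_simps)

section \<open>Energy decay\<close>

definition elastic_form ::
    "(real^'d::finite) set \<Rightarrow> real^'d^'d^'d^'d \<Rightarrow> (real^'d \<Rightarrow> real^'d^'d) \<Rightarrow> (real^'d \<Rightarrow> real^'d^'d) \<Rightarrow> real"
  where "elastic_form \<Omega> C e w = L2_inner \<Omega> (\<lambda>x. tensor_apply C (e x)) w"

text \<open>
  The integral splits because each of the three parts is integrable; the default value \<open>0\<close> of the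
  integral of a non-integrable function would obey no such identity.
\<close>

lemma free_energy_eq:
  assumes \<Omega>: "open \<Omega>" "bounded \<Omega>"
    and \<Psi>: "(\<lambda>x. \<Psi> (\<phi> x)) \<in> L2 \<Omega>" and \<phi>: "grad \<Omega> \<phi> \<in> L2 \<Omega>"
    and E: "elastic_strain \<Omega> \<xi> \<phi> u \<in> L2 \<Omega>"
  shows "free_energy \<Omega> \<gamma> \<l> \<xi> \<Psi> C \<phi> u =
           \<gamma> / \<l> * (LINT x|lebesgue_on \<Omega>. \<Psi> (\<phi> x))
           + \<gamma> * \<l> * (L2_inner \<Omega> (grad \<Omega> \<phi>) (grad \<Omega> \<phi>) / 2)
           + elastic_form \<Omega> C (elastic_strain \<Omega> \<xi> \<phi> u) (elastic_strain \<Omega> \<xi> \<phi> u) / 2"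
proof -
  have \<Omega>m: "\<Omega> \<in> sets lebesgue" using \<Omega> by auto
  let ?E = "elastic_strain \<Omega> \<xi> \<phi> u"
  have i1: "integrable (lebesgue_on \<Omega>) (\<lambda>x. \<Psi> (\<phi> x))" by (rule L2_imp_integrable[OF \<Omega> \<Psi>])
  have i2: "integrable (lebesgue_on \<Omega>) (\<lambda>x. grad \<Omega> \<phi> x \<bullet> grad \<Omega> \<phi> x)"
    by (rule integrable_L2_inner[OF \<Omega>m \<phi> \<phi>])
  have i3: "integrable (lebesgue_on \<Omega>) (\<lambda>x. tensor_apply C (?E x) \<bullet> ?E x)"
    by (intro integrable_L2_inner L2_linear[OF _ _ linear_tensor_apply] \<Omega>m E)
  have "free_energy \<Omega> \<gamma> \<l> \<xi> \<Psi> C \<phi> u = (LINT x|lebesgue_on \<Omega>.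
      (\<gamma> / \<l> * \<Psi> (\<phi> x) + \<gamma> * \<l> / 2 * (grad \<Omega> \<phi> x \<bullet> grad \<Omega> \<phi> x))
      + 1/2 * (tensor_apply C (?E x) \<bullet> ?E x))"
    using \<Omega>m unfolding free_energy_def set_lebesgue_integral_def
    by (simp add: integral_restrict_space power2_norm_eq_inner inner_commute algebra_simps)
  also have "\<dots> = \<gamma> / \<l> * (LINT x|lebesgue_on \<Omega>. \<Psi> (\<phi> x))
      + \<gamma> * \<l> / 2 * (LINT x|lebesgue_on \<Omega>. grad \<Omega> \<phi> x \<bullet> grad \<Omega> \<phi> x)
      + 1/2 * (LINT x|lebesgue_on \<Omega>. tensor_apply C (?E x) \<bullet> ?E x)"
    using i1 i2 i3 by simp
  finally show ?thesis by (simp add: L2_inner_eq[OF \<Omega>m] elastic_form_def)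
qed

text \<open>
  The first equation of the scheme tested with \<open>\<mu>\<close>: dissipation has a sign.
\<close>

lemma chemical_potential_work_nonpos:
  assumes \<tau>: "\<tau> > 0" and m: "m > 0" and \<Omega>: "\<Omega> \<in> sets lebesgue"
    and Q: "\<phi> \<in> L2 \<Omega>" "\<phi>' \<in> L2 \<Omega>" "\<mu> \<in> H1 \<Omega>"
    and eq: "L2_inner \<Omega> (\<lambda>x. (\<phi> x - \<phi>' x) / \<tau>) \<mu>
             + L2_inner \<Omega> (\<lambda>x. m *\<^sub>R grad \<Omega> \<mu> x) (grad \<Omega> \<mu>) = 0"
  shows "L2_inner \<Omega> \<mu> (\<lambda>x. \<phi> x - \<phi>' x) \<le> 0"
proof -
  have a: "L2_inner \<Omega> (\<lambda>x. (\<phi> x - \<phi>' x) / \<tau>) \<mu> = L2_inner \<Omega> \<mu> (\<lambda>x. \<phi> x - \<phi>' x) / \<tau>"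
    by (simp add: L2_inner_eq[OF \<Omega>] mult.commute)
  have b: "L2_inner \<Omega> (\<lambda>x. m *\<^sub>R grad \<Omega> \<mu> x) (grad \<Omega> \<mu>) \<ge> 0"
    using m by (simp add: L2_inner_eq[OF \<Omega>] integral_nonneg_AE)
  have "L2_inner \<Omega> \<mu> (\<lambda>x. \<phi> x - \<phi>' x) / \<tau> \<le> 0" using eq a b by linarith
  then show ?thesis using \<tau> by (simp add: divide_le_0_iff)
qed

lemma potential_energy_difference_le:
  assumes \<Omega>: "open \<Omega>" "bounded \<Omega>" and F: "fe_space \<Omega> F"
    and \<phi>: "\<phi> \<in> F" "\<phi> \<in> L2 \<Omega>" and \<phi>': "\<phi>' \<in> F" "\<phi>' \<in> L2 \<Omega>"
    and \<Psi>: "double_well_split \<Psi> \<Psi>c \<Psi>e L"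
  shows "(LINT x|lebesgue_on \<Omega>. \<Psi> (\<phi> x)) - (LINT x|lebesgue_on \<Omega>. \<Psi> (\<phi>' x))
         \<le> L2_inner \<Omega> (\<lambda>x. deriv \<Psi>c (\<phi> x) - deriv \<Psi>e (\<phi>' x)) (\<lambda>x. \<phi> x - \<phi>' x)"
proof -
  have \<Omega>m: "\<Omega> \<in> sets lebesgue" using \<Omega> by auto
  have i: "integrable (lebesgue_on \<Omega>) (\<lambda>x. \<Psi> (\<phi> x))" "integrable (lebesgue_on \<Omega>) (\<lambda>x. \<Psi> (\<phi>' x))"
    by (intro L2_imp_integrable[OF \<Omega>] L2_potential[OF \<Omega> F _ _ \<Psi>] \<phi> \<phi>')+
  have j: "integrable (lebesgue_on \<Omega>)
      (\<lambda>x. (deriv \<Psi>c (\<phi> x) - deriv \<Psi>e (\<phi>' x)) \<bullet> (\<phi> x - \<phi>' x))"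
    by (intro integrable_L2_inner L2_diff L2_deriv_potential[OF \<Omega> F _ _ \<Psi>] \<phi> \<phi>' \<Omega>m)
  have "(LINT x|lebesgue_on \<Omega>. \<Psi> (\<phi> x)) - (LINT x|lebesgue_on \<Omega>. \<Psi> (\<phi>' x))
      = (LINT x|lebesgue_on \<Omega>. \<Psi> (\<phi> x) - \<Psi> (\<phi>' x))"
    using i by simp
  also have "\<dots> \<le> (LINT x|lebesgue_on \<Omega>. (deriv \<Psi>c (\<phi> x) - deriv \<Psi>e (\<phi>' x)) \<bullet> (\<phi> x - \<phi>' x))"
    using i j by (intro integral_mono) (auto intro: double_well_split_le[OF \<Psi>])
  finally show ?thesis by (simp add: L2_inner_eq[OF \<Omega>m])
qed

lemma gradient_energy_difference_le:
  assumes \<Omega>: "open \<Omega>" "bounded \<Omega>" and \<phi>: "\<phi> \<in> H1 \<Omega>" and \<phi>': "\<phi>' \<in> H1 \<Omega>"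
  shows "L2_inner \<Omega> (grad \<Omega> \<phi>) (grad \<Omega> \<phi>) / 2 - L2_inner \<Omega> (grad \<Omega> \<phi>') (grad \<Omega> \<phi>') / 2
         \<le> L2_inner \<Omega> (grad \<Omega> \<phi>) (grad \<Omega> (\<lambda>x. \<phi> x - \<phi>' x))"
proof -
  have \<Omega>m: "\<Omega> \<in> sets lebesgue" using \<Omega> by auto
  note g = grad_L2[OF \<phi>] grad_L2[OF \<phi>']
  have "L2_inner \<Omega> (grad \<Omega> \<phi>) (grad \<Omega> (\<lambda>x. \<phi> x - \<phi>' x))
      = L2_inner \<Omega> (grad \<Omega> \<phi>) (\<lambda>x. grad \<Omega> \<phi> x - grad \<Omega> \<phi>' x)"
    by (rule L2_inner_cong_AE[OF \<Omega>m g(1) grad_L2[OF H1_diff[OF \<Omega> \<phi> \<phi>']] g(1) L2_diff[OF \<Omega>m g]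
          _ grad_diff[OF \<Omega> \<phi> \<phi>']]) simp
  then show ?thesis
    using L2_inner_convex[OF \<Omega>m g] by (simp only:)
qed

text \<open>
  The right side is written with the two test functions \<open>u - u'\<close> and \<open>\<phi> - \<phi>'\<close> of the scheme, so
  that the equilibrium equation cancels its first term.
\<close>

lemma elastic_energy_difference_le:
  fixes \<xi> :: real
  assumes \<Omega>: "open \<Omega>" "bounded \<Omega>"
    and C: "inner_product_on \<Omega> (sym_L2 \<Omega>) (elastic_form \<Omega> C)"
    and \<phi>: "\<phi> \<in> L2 \<Omega>" and \<phi>': "\<phi>' \<in> L2 \<Omega>"
    and u: "\<And>i. (\<lambda>x. u x $ i) \<in> H1 \<Omega>" and u': "\<And>i. (\<lambda>x. u' x $ i) \<in> H1 \<Omega>"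
  defines "E \<equiv> elastic_strain \<Omega> \<xi> \<phi> u" and "E' \<equiv> elastic_strain \<Omega> \<xi> \<phi>' u'"
  shows "elastic_form \<Omega> C E E / 2 - elastic_form \<Omega> C E' E' / 2
         \<le> elastic_form \<Omega> C E (strain \<Omega> (\<lambda>x. u x - u' x))
           - elastic_form \<Omega> C E (\<lambda>x. ((\<phi> x - \<phi>' x) * \<xi>) *\<^sub>R mat 1)"
proof -
  have \<Omega>m: "\<Omega> \<in> sets lebesgue" using \<Omega> by auto
  note closed = sym_L2_add[OF \<Omega>m] sym_L2_scaleR[OF \<Omega>m]
  have E: "E \<in> sym_L2 \<Omega>" "E' \<in> sym_L2 \<Omega>"
    unfolding E_def E'_def by (intro elastic_strain_sym_L2 \<Omega>m \<phi> \<phi>' u u')+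
  have s: "strain \<Omega> (\<lambda>x. u x - u' x) \<in> sym_L2 \<Omega>"
    by (intro strain_sym_L2 \<Omega>m) (simp add: H1_diff[OF \<Omega> u u'])
  have p: "(\<lambda>x. ((\<phi> x - \<phi>' x) * \<xi>) *\<^sub>R mat 1) \<in> sym_L2 \<Omega>"
    by (intro spherical_sym_L2 L2_diff \<Omega>m \<phi> \<phi>')
  have sym: "e \<in> L2 \<Omega>" if "e \<in> sym_L2 \<Omega>" for e using that by (simp add: sym_L2_def)
  have T: "(\<lambda>x. tensor_apply C (E x)) \<in> L2 \<Omega>"
    by (rule L2_linear[OF \<Omega>m sym[OF E(1)] linear_tensor_apply])
  have eq: "AE x in lebesgue_on \<Omega>. E x - E' x
      = strain \<Omega> (\<lambda>x. u x - u' x) x - ((\<phi> x - \<phi>' x) * \<xi>) *\<^sub>R mat 1"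
    using elastic_strain_diff[OF \<Omega> u u', of \<phi> \<phi>' \<xi>] unfolding E_def E'_def
    by eventually_elim (simp only:)
  have "elastic_form \<Omega> C E E / 2 - elastic_form \<Omega> C E' E' / 2
      \<le> elastic_form \<Omega> C E (\<lambda>x. E x - E' x)"
    by (rule inner_product_on_convex[OF C closed E])
  also have "\<dots>
      = elastic_form \<Omega> C E (\<lambda>x. strain \<Omega> (\<lambda>x. u x - u' x) x - ((\<phi> x - \<phi>' x) * \<xi>) *\<^sub>R mat 1)"
    unfolding elastic_form_def
    by (rule L2_inner_cong_AE[OF \<Omega>m T sym[OF sym_L2_diff[OF \<Omega>m E]] T
          sym[OF sym_L2_diff[OF \<Omega>m s p]] _ eq]) simp
  also have "\<dots> = elastic_form \<Omega> C E (strain \<Omega> (\<lambda>x. u x - u' x))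
      - elastic_form \<Omega> C E (\<lambda>x. ((\<phi> x - \<phi>' x) * \<xi>) *\<^sub>R mat 1)"
    by (rule inner_product_on_diff_right[OF C closed E(1) s p])
  finally show ?thesis .
qed

lemma time_stepD:
  assumes "time_step \<Omega> Q V \<gamma> \<l> m \<xi> \<Psi>c \<Psi>e C \<tau> \<phi>' \<phi> \<mu> u"
  shows time_step_mem: "\<phi> \<in> Q" "\<mu> \<in> Q" "u \<in> V"
    and time_step_phase_field: "q \<in> Q \<Longrightarrow> L2_inner \<Omega> (\<lambda>x. (\<phi> x - \<phi>' x) / \<tau>) q
          + L2_inner \<Omega> (\<lambda>x. m *\<^sub>R grad \<Omega> \<mu> x) (grad \<Omega> q) = 0"
    and time_step_chemical_potential: "q \<in> Q \<Longrightarrow> L2_inner \<Omega> \<mu> q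
          - \<gamma> * \<l> * L2_inner \<Omega> (grad \<Omega> \<phi>) (grad \<Omega> q)
          - \<gamma> / \<l> * L2_inner \<Omega> (\<lambda>x. deriv \<Psi>c (\<phi> x) - deriv \<Psi>e (\<phi>' x)) q
          + elastic_form \<Omega> C (elastic_strain \<Omega> \<xi> \<phi> u) (\<lambda>x. (q x * \<xi>) *\<^sub>R mat 1) = 0"
    and time_step_equilibrium:
      "v \<in> V \<Longrightarrow> elastic_form \<Omega> C (elastic_strain \<Omega> \<xi> \<phi> u) (strain \<Omega> v) = 0"
  using assms unfolding time_step_def elastic_form_def by blast+

text \<open>
  One step from arbitrary old iterates. The test functions \<open>\<mu>\<close>, \<open>\<delta> = \<phi> - \<phi>'\<close> and \<open>w = u - u'\<close> are
  admissible because the finite element spaces are linear.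
\<close>

lemma time_step_energy_decay:
  assumes \<Omega>: "open \<Omega>" "bounded \<Omega>"
    and Q: "conforming_scalar_space \<Omega> Q" and V: "conforming_vector_space \<Omega> V"
    and pos: "\<gamma> > 0" "\<l> > 0" "m > 0" "\<tau> > 0"
    and \<Psi>: "double_well_split \<Psi> \<Psi>c \<Psi>e L"
    and C: "elasticity_tensor \<Omega> C c K"
    and old: "\<phi>' \<in> Q" "u' \<in> V"
    and step: "time_step \<Omega> Q V \<gamma> \<l> m \<xi> \<Psi>c \<Psi>e C \<tau> \<phi>' \<phi> \<mu> u"
  shows "free_energy \<Omega> \<gamma> \<l> \<xi> \<Psi> C \<phi> u \<le> free_energy \<Omega> \<gamma> \<l> \<xi> \<Psi> C \<phi>' u'"
proof -
  have \<Omega>m: "\<Omega> \<in> sets lebesgue" using \<Omega> by auto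
  note new = time_step_mem[OF step]
  have feQ: "fe_space \<Omega> Q" and QH1: "\<And>q. q \<in> Q \<Longrightarrow> q \<in> H1 \<Omega>"
    using Q unfolding conforming_scalar_space_def by blast+
  have feV: "fe_space \<Omega> V" and VH1: "\<And>v i. v \<in> V \<Longrightarrow> (\<lambda>x. v x $ i) \<in> H1 \<Omega>"
    using V unfolding conforming_vector_space_def H1_0_def by blast+
  note QL2 = QH1[THEN H1_imp_L2]
  have C': "inner_product_on \<Omega> (sym_L2 \<Omega>) (elastic_form \<Omega> C)"
    using C unfolding elasticity_tensor_def elastic_form_def[abs_def] by (elim conjE)
  define \<delta> where "\<delta> = (\<lambda>x. \<phi> x - \<phi>' x)"
  define w where "w = (\<lambda>x. u x - u' x)"
  have \<delta>: "\<delta> \<in> Q" unfolding \<delta>_def by (rule fe_space_diff[OF feQ new(1) old(1)])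
  have w: "w \<in> V" unfolding w_def by (rule fe_space_diff[OF feV new(3) old(2)])
  define E where "E = elastic_strain \<Omega> \<xi> \<phi> u"
  define E' where "E' = elastic_strain \<Omega> \<xi> \<phi>' u'"
  define P where "P = (LINT x|lebesgue_on \<Omega>. \<Psi> (\<phi> x))"
  define P' where "P' = (LINT x|lebesgue_on \<Omega>. \<Psi> (\<phi>' x))"
  define p where "p = L2_inner \<Omega> (\<lambda>x. deriv \<Psi>c (\<phi> x) - deriv \<Psi>e (\<phi>' x)) \<delta>"
  define G where "G = L2_inner \<Omega> (grad \<Omega> \<phi>) (grad \<Omega> \<phi>) / 2"
  define G' where "G' = L2_inner \<Omega> (grad \<Omega> \<phi>') (grad \<Omega> \<phi>') / 2"
  define g where "g = L2_inner \<Omega> (grad \<Omega> \<phi>) (grad \<Omega> \<delta>)"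
  define s where "s = elastic_form \<Omega> C E (\<lambda>x. (\<delta> x * \<xi>) *\<^sub>R mat 1)"
  have energy: "free_energy \<Omega> \<gamma> \<l> \<xi> \<Psi> C \<psi> v =
           \<gamma> / \<l> * (LINT x|lebesgue_on \<Omega>. \<Psi> (\<psi> x))
           + \<gamma> * \<l> * (L2_inner \<Omega> (grad \<Omega> \<psi>) (grad \<Omega> \<psi>) / 2)
           + elastic_form \<Omega> C (elastic_strain \<Omega> \<xi> \<psi> v) (elastic_strain \<Omega> \<xi> \<psi> v) / 2"
    if \<psi>: "\<psi> \<in> Q" and v: "v \<in> V" for \<psi> v
  proof (rule free_energy_eq[OF \<Omega>])
    show "(\<lambda>x. \<Psi> (\<psi> x)) \<in> L2 \<Omega>" by (rule L2_potential[OF \<Omega> feQ \<psi> QL2[OF \<psi>] \<Psi>])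
    show "grad \<Omega> \<psi> \<in> L2 \<Omega>" by (rule grad_L2[OF QH1[OF \<psi>]])
    show "elastic_strain \<Omega> \<xi> \<psi> v \<in> L2 \<Omega>"
      using elastic_strain_sym_L2[OF \<Omega>m QL2[OF \<psi>] VH1[OF v]] by (simp only: sym_L2_def mem_Collect_eq)
  qed
  have "L2_inner \<Omega> \<mu> \<delta> \<le> 0"
    unfolding \<delta>_def
    by (rule chemical_potential_work_nonpos[OF pos(4,3) \<Omega>m QL2[OF new(1)] QL2[OF old(1)]
          QH1[OF new(2)] time_step_phase_field[OF step new(2)]])
  moreover have "L2_inner \<Omega> \<mu> \<delta> - \<gamma> * \<l> * g - \<gamma> / \<l> * p + s = 0"
    unfolding g_def p_def s_def E_def by (rule time_step_chemical_potential[OF step \<delta>])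
  moreover have "elastic_form \<Omega> C E E / 2 - elastic_form \<Omega> C E' E' / 2 \<le> - s"
  proof -
    have "elastic_form \<Omega> C E E / 2 - elastic_form \<Omega> C E' E' / 2
        \<le> elastic_form \<Omega> C E (strain \<Omega> w) - s"
      unfolding E_def E'_def s_def w_def \<delta>_def
      by (rule elastic_energy_difference_le[OF \<Omega> C' QL2[OF new(1)] QL2[OF old(1)]
            VH1[OF new(3)] VH1[OF old(2)]])
    also have "elastic_form \<Omega> C E (strain \<Omega> w) = 0"
      unfolding E_def by (rule time_step_equilibrium[OF step w])
    finally show ?thesis by simp
  qed
  moreover have "\<gamma> / \<l> * P - \<gamma> / \<l> * P' \<le> \<gamma> / \<l> * p"
  proof -
    have "P - P' \<le> p"
      unfolding P_def P'_def p_def \<delta>_def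
      by (rule potential_energy_difference_le[OF \<Omega> feQ new(1) QL2[OF new(1)] old(1) QL2[OF old(1)] \<Psi>])
    from mult_left_mono[OF this, of "\<gamma> / \<l>"] show ?thesis
      using pos by (simp add: right_diff_distrib)
  qed
  moreover have "\<gamma> * \<l> * G - \<gamma> * \<l> * G' \<le> \<gamma> * \<l> * g"
  proof -
    have "G - G' \<le> g"
      unfolding G_def G'_def g_def \<delta>_def
      by (rule gradient_energy_difference_le[OF \<Omega> QH1[OF new(1)] QH1[OF old(1)]])
    from mult_left_mono[OF this, of "\<gamma> * \<l>"] show ?thesis
      using pos by (simp add: right_diff_distrib)
  qed
  ultimately have "\<gamma> / \<l> * P + \<gamma> * \<l> * G + elastic_form \<Omega> C E E / 2
      \<le> \<gamma> / \<l> * P' + \<gamma> * \<l> * G' + elastic_form \<Omega> C E' E' / 2"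
    by linarith
  then show ?thesis
    unfolding energy[OF new(1,3)] energy[OF old] P_def P'_def G_def G'_def E_def E'_def .
qed

theorem theorem1:
  fixes \<Omega> :: "(real^'d::finite) set"
    and Q :: "(real^'d \<Rightarrow> real) set"
    and V :: "(real^'d \<Rightarrow> real^'d) set"
    and \<gamma> \<l> m \<xi> \<tau> L c\<^sub>C C\<^sub>C :: real
    and \<Psi> \<Psi>\<^sub>c \<Psi>\<^sub>e :: "real \<Rightarrow> real"
    and C :: "real^'d^'d^'d^'d"
    and \<phi> \<mu> :: "nat \<Rightarrow> real^'d \<Rightarrow> real"
    and u :: "nat \<Rightarrow> real^'d \<Rightarrow> real^'d"
    and n :: nat
  assumes "lipschitz_domain \<Omega>"
    and "conforming_scalar_space \<Omega> Q"
    and "conforming_vector_space \<Omega> V"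
    and "\<gamma> > 0" and "\<l> > 0" and "m > 0"
    and "double_well_split \<Psi> \<Psi>\<^sub>c \<Psi>\<^sub>e L"
    and "elasticity_tensor \<Omega> C c\<^sub>C C\<^sub>C"
    and "\<tau> > 0"
    and "\<phi> 0 \<in> Q" and "u 0 \<in> V"
    and "n \<ge> 1"
    and "\<forall>k\<in>{1..n}. time_step \<Omega> Q V \<gamma> \<l> m \<xi> \<Psi>\<^sub>c \<Psi>\<^sub>e C \<tau> (\<phi> (k - 1)) (\<phi> k) (\<mu> k) (u k)"
  shows "free_energy \<Omega> \<gamma> \<l> \<xi> \<Psi> C (\<phi> n) (u n) \<le> free_energy \<Omega> \<gamma> \<l> \<xi> \<Psi> C (\<phi> (n - 1)) (u (n - 1))"
proof (rule time_step_energy_decay[OF _ _ assms(2-6,9,7,8)])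
  show "open \<Omega>" "bounded \<Omega>" using assms(1) by (auto simp: lipschitz_domain_def)
  show "time_step \<Omega> Q V \<gamma> \<l> m \<xi> \<Psi>\<^sub>c \<Psi>\<^sub>e C \<tau> (\<phi> (n - 1)) (\<phi> n) (\<mu> n) (u n)"
    using assms(12,13) by auto
  have "\<phi> k \<in> Q \<and> u k \<in> V" if "k \<le> n" for k
  proof (cases "k = 0")
    case False
    then have "time_step \<Omega> Q V \<gamma> \<l> m \<xi> \<Psi>\<^sub>c \<Psi>\<^sub>e C \<tau> (\<phi> (k - 1)) (\<phi> k) (\<mu> k) (u k)"
      using that assms(13) by simp
    then show ?thesis by (blast dest: time_step_mem)
  qed (simp add: assms(10,11))
  then show "\<phi> (n - 1) \<in> Q" "u (n - 1) \<in> V" by auto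
qed

end
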